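(* Let $n\ge 1$, $\mathbf{B}=[-1,1]^n$, and let $g=g_1+g_2\in\mathbb{R}[x_1,\ldots,x_n]$ where $g_1$ is a homogeneous polynomial of degree $1$ and $g_2$ is a homogeneous polynomial of degree $2$. Let $a\leq b$ be real numbers and let $\mathbf{K}=\{\mathbf{x}\in\mathbb{R}^n:\ a\le g(\mathbf{x})\le b\}$, and assume $\mathbf{K}\subset(-1,1)^n$. Let $\lambda$ be the Lebesgue measure on $\mathbf{B}$ normalized to a probability measure, let $\#\lambda$ be the pushforward of $\lambda$ on $\mathbb{R}^2$ by the mapping $\mathbf{x}\mapsto(g_1(\mathbf{x}),g_2(\mathbf{x}))$, $\mathbf{x}\in\mathbf{B}$, let $\Theta=\{(g_1(\mathbf{x}),g_2(\mathbf{x})):\mathbf{x}\in\mathbf{B}\}$ and $S=\{\mathbf{z}\in\Theta:\ a\le z_1+z_2\le b\}$. Let $\tilde h(\mathbf{z})=(b-z_1-z_2)(z_1+z_2-a)$ and, for $i,j\in\mathbb{N}$, $$q_{ij}(\mathbf{z})=(n+i+2j)\,z_1^iz_2^j\,(b-z_1-z_2)(z_1+z_2-a)+(z_1+2z_2)\,z_1^iz_2^j\,(a+b-2z_1-2z_2).$$ For every integer $d\ge 1$ let $$\rho_d=\max_{\boldsymbol{\phi}}\bigl\{\phi_{00}:\ 0\preceq\mathbf{M}_d(\boldsymbol{\phi})\preceq\mathbf{M}_d(\#\lambda),\ \ \mathbf{M}_{d-1}(\tilde h\,\boldsymbol{\phi})\succeq0\bigr\},$$ $$\tau_d=\max_{\boldsymbol{\phi}}\bigl\{\phi_{00}:\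 0\preceq\mathbf{M}_d(\boldsymbol{\phi})\preceq\mathbf{M}_d(\#\lambda),\ \ \mathbf{M}_{d-1}(\tilde h\,\boldsymbol{\phi})\succeq0,\ \ L_{\boldsymbol{\phi}}(q_{ij})=0\ \text{ for all }(i,j)\text{ with }\deg(q_{ij})\le 2d\bigr\},$$ where both maxima are over finite bivariate real sequences $\boldsymbol{\phi}=(\phi_{ij})_{i+j\le 2d}$. Then $$\#\lambda(S)\,\le\,\tau_d\,\le\,\rho_d\quad\text{for all } d\ge 1,$$ and $(\tau_d)_{d\geq 1}$ is monotone nonincreasing and converges to $\#\lambda(S)$ as $d\to\infty$.
   Context: $\mathbb{N}=\{0,1,2,\ldots\}$. The pushforward $\#\lambda$ is the Borel measure on $\mathbb{R}^2$ given by $\#\lambda(C)=\lambda(\{\mathbf{x}\in\mathbf{B}:(g_1(\mathbf{x}),g_2(\mathbf{x}))\in C\})$, with moments $\#\lambda_{ij}=\int z_1^iz_2^j\,d\#\lambda(\mathbf{z})=\int_{\mathbf{B}}g_1(\mathbf{x})^i g_2(\mathbf{x})^j\,d\lambda(\mathbf{x})$. For $d\in\mathbb{N}$ let $\mathbb{N}^2_d=\{\alpha\in\mathbb{N}^2:\alpha_1+\alpha_2\le d\}$. For a bivariate sequence $\boldsymbol{\phi}=(\phi_\alpha)$, the moment matrix $\mathbf{M}_d(\boldsymbol{\phi})$ is the real symmetric matrix with rows and columns indexed by $\mathbb{N}^2_d$ and entries $\mathbf{M}_d(\boldsymbol{\phi})(\alpha,\beta)=\phi_{\alpha+\beta}$;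 $\mathbf{M}_d(\#\lambda)$ is this matrix for the moment sequence of $\#\lambda$. For a polynomial $p(\mathbf{z})=\sum_\gamma p_\gamma\mathbf{z}^\gamma$, the localizing matrix $\mathbf{M}_{d}(p\,\boldsymbol{\phi})$ is indexed by $\mathbb{N}^2_{d}$ with entries $\mathbf{M}_{d}(p\,\boldsymbol{\phi})(\alpha,\beta)=\sum_\gamma p_\gamma\,\phi_{\alpha+\beta+\gamma}$. $L_{\boldsymbol{\phi}}$ is the Riesz functional $q=\sum_\alpha q_\alpha\mathbf{z}^\alpha\mapsto L_{\boldsymbol{\phi}}(q)=\sum_\alpha q_\alpha\phi_\alpha$. $\mathbf{A}\preceq\mathbf{C}$ means that $\mathbf{C}-\mathbf{A}$ is positive semidefinite. *)

theory Defs
  imports "HOL-Analysis.Analysis" "HOL-Library.Poly_Mapping"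
begin

text \<open>
  A polynomial in the variables \<open>x\<^sub>i\<close>, \<open>i :: 'n\<close>, is an element of the monoid algebra
  \<open>('n \<Rightarrow>\<^sub>0 nat) \<Rightarrow>\<^sub>0 real\<close>; its keys are exponent vectors.
\<close>

type_synonym 'n rpoly = "('n \<Rightarrow>\<^sub>0 nat) \<Rightarrow>\<^sub>0 real"

definition peval :: "'n::finite rpoly \<Rightarrow> real ^ 'n \<Rightarrow> real" where
  "peval p x = (\<Sum>m\<in>Poly_Mapping.keys p.
     Poly_Mapping.lookup p m * (\<Prod>i\<in>UNIV. (x $ i) ^ Poly_Mapping.lookup m i))"

text \<open>As usual, the zero polynomial counts as homogeneous of every degree.\<close>

definition homogeneous :: "nat \<Rightarrow> 'n::finite rpoly \<Rightarrow> bool" where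
  "homogeneous k p \<longleftrightarrow>
     (\<forall>m\<in>Poly_Mapping.keys p. (\<Sum>i\<in>UNIV. Poly_Mapping.lookup m i) = k)"

text \<open>
  In \<open>real ^ 'n\<close>, \<open>1\<close> is the all-ones vector, so \<open>cbox (-1) 1\<close> is \<open>[-1,1]\<^sup>n\<close> and
  \<open>box (-1) 1\<close> is \<open>(-1,1)\<^sup>n\<close>.  The measure \<open>unif_cube\<close> lives on all of \<open>real ^ 'n\<close> but is
  concentrated on \<open>cbox (-1) 1\<close>.
\<close>

definition unif_cube :: "(real ^ 'n::finite) measure" where
  "unif_cube = uniform_measure lborel (cbox (-1) 1)"

definition pushforward :: "'n::finite rpoly \<Rightarrow> 'n rpoly \<Rightarrow> (real \<times> real) measure" where
  "pushforward g1 g2 = distr unif_cube borel (\<lambda>x. (peval g1 x, peval g2 x))"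

definition moments :: "(real \<times> real) measure \<Rightarrow> nat \<times> nat \<Rightarrow> real" where
  "moments \<mu> \<alpha> = (LINT z|\<mu>. fst z ^ fst \<alpha> * snd z ^ snd \<alpha>)"

text \<open>
  A bivariate polynomial is an element of the monoid algebra \<open>(nat \<times> nat) \<Rightarrow>\<^sub>0 real\<close>; the key
  \<open>(i, j)\<close> stands for the monomial \<open>z\<^sub>1\<^sup>i z\<^sub>2\<^sup>j\<close>.
\<close>

type_synonym bipoly = "(nat \<times> nat) \<Rightarrow>\<^sub>0 real"

definition cst :: "real \<Rightarrow> bipoly" where
  "cst c = Poly_Mapping.single (0, 0) c"

definition z1 :: bipoly where
  "z1 = Poly_Mapping.single (1, 0) 1"

definition z2 :: bipoly where
  "z2 = Poly_Mapping.single (0, 1) 1"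

definition total_degree :: "bipoly \<Rightarrow> nat" where
  "total_degree p = Max (insert 0 ((\<lambda>\<alpha>. fst \<alpha> + snd \<alpha>) ` Poly_Mapping.keys p))"

definition htilde :: "real \<Rightarrow> real \<Rightarrow> bipoly" where
  "htilde a b = (cst b - z1 - z2) * (z1 + z2 - cst a)"

definition qpoly :: "nat \<Rightarrow> real \<Rightarrow> real \<Rightarrow> nat \<Rightarrow> nat \<Rightarrow> bipoly" where
  "qpoly n a b i j =
     cst (real (n + i + 2 * j)) * z1 ^ i * z2 ^ j * (cst b - z1 - z2) * (z1 + z2 - cst a)
     + (z1 + cst 2 * z2) * z1 ^ i * z2 ^ j * (cst (a + b) - cst 2 * z1 - cst 2 * z2)"

definition idx :: "nat \<Rightarrow> (nat \<times> nat) set" where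
  "idx d = {\<alpha>. fst \<alpha> + snd \<alpha> \<le> d}"

text \<open>
  Matrices are functions of a row and a column index; the finite index set \<open>I\<close> on which they
  are considered is an argument of the predicates below.
\<close>

definition psd_on :: "'i set \<Rightarrow> ('i \<Rightarrow> 'i \<Rightarrow> real) \<Rightarrow> bool" where
  "psd_on I A \<longleftrightarrow>
     (\<forall>\<alpha>\<in>I. \<forall>\<beta>\<in>I. A \<alpha> \<beta> = A \<beta> \<alpha>) \<and>
     (\<forall>v. 0 \<le> (\<Sum>\<alpha>\<in>I. \<Sum>\<beta>\<in>I. v \<alpha> * A \<alpha> \<beta> * v \<beta>))"

definition loewner_le :: "'i set \<Rightarrow> ('i \<Rightarrow> 'i \<Rightarrow> real) \<Rightarrow> ('i \<Rightarrow> 'i \<Rightarrow> real) \<Rightarrow> bool" where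
  "loewner_le I A C \<longleftrightarrow> psd_on I (\<lambda>\<alpha> \<beta>. C \<alpha> \<beta> - A \<alpha> \<beta>)"

definition moment_matrix :: "(nat \<times> nat \<Rightarrow> real) \<Rightarrow> nat \<times> nat \<Rightarrow> nat \<times> nat \<Rightarrow> real" where
  "moment_matrix \<phi> \<alpha> \<beta> = \<phi> (\<alpha> + \<beta>)"

definition localizing_matrix ::
    "bipoly \<Rightarrow> (nat \<times> nat \<Rightarrow> real) \<Rightarrow> nat \<times> nat \<Rightarrow> nat \<times> nat \<Rightarrow> real" where
  "localizing_matrix p \<phi> \<alpha> \<beta> =
     (\<Sum>\<gamma>\<in>Poly_Mapping.keys p. Poly_Mapping.lookup p \<gamma> * \<phi> (\<alpha> + \<beta> + \<gamma>))"

definition riesz :: "(nat \<times> nat \<Rightarrow> real) \<Rightarrow> bipoly \<Rightarrow> real" where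
  "riesz \<phi> q = (\<Sum>\<alpha>\<in>Poly_Mapping.keys q. Poly_Mapping.lookup q \<alpha> * \<phi> \<alpha>)"

text \<open>
  A finite sequence \<open>(\<phi>\<^sub>i\<^sub>j)\<close>, \<open>i + j \<le> 2 * d\<close>, is an extensional function on \<open>idx (2 * d)\<close>.
\<close>

definition rho_feasible ::
    "real \<Rightarrow> real \<Rightarrow> (real \<times> real) measure \<Rightarrow> nat \<Rightarrow> (nat \<times> nat \<Rightarrow> real) set" where
  "rho_feasible a b \<mu> d =
     {\<phi> \<in> idx (2 * d) \<rightarrow>\<^sub>E UNIV.
        loewner_le (idx d) (\<lambda>_ _. 0) (moment_matrix \<phi>) \<and>
        loewner_le (idx d) (moment_matrix \<phi>) (moment_matrix (moments \<mu>)) \<and>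
        loewner_le (idx (d - 1)) (\<lambda>_ _. 0) (localizing_matrix (htilde a b) \<phi>)}"

definition tau_feasible ::
    "nat \<Rightarrow> real \<Rightarrow> real \<Rightarrow> (real \<times> real) measure \<Rightarrow> nat \<Rightarrow> (nat \<times> nat \<Rightarrow> real) set" where
  "tau_feasible n a b \<mu> d =
     {\<phi> \<in> rho_feasible a b \<mu> d.
        \<forall>i j. total_degree (qpoly n a b i j) \<le> 2 * d \<longrightarrow> riesz \<phi> (qpoly n a b i j) = 0}"

text \<open>\<open>GREATEST\<close> is the maximum, and is unspecified if the maximum is not attained.\<close>

definition rho :: "real \<Rightarrow> real \<Rightarrow> (real \<times> real) measure \<Rightarrow> nat \<Rightarrow> real" where
  "rho a b \<mu> d = (GREATEST v. v \<in> (\<lambda>\<phi>. \<phi> (0, 0)) ` rho_feasible a b \<mu> d)"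

definition tau :: "nat \<Rightarrow> real \<Rightarrow> real \<Rightarrow> (real \<times> real) measure \<Rightarrow> nat \<Rightarrow> real" where
  "tau n a b \<mu> d = (GREATEST v. v \<in> (\<lambda>\<phi>. \<phi> (0, 0)) ` tau_feasible n a b \<mu> d)"

end

theory Submission
  imports Defs
begin

text \<open>
  The moment matrix constraints say that the Riesz functional \<open>L\<close> of a feasible sequence satisfies
  \<open>0 \<le> L(p\<^sup>2) \<le> \<integral>p\<^sup>2 d\<Lambda>\<close> and \<open>L(h p\<^sup>2) \<ge> 0\<close>, where \<open>h\<close> is the localizing polynomial. They bound
  every coordinate, so the feasible sets are compact and the maxima are attained.

  The moments of \<open>\<Lambda>\<close> restricted to \<open>S\<close> are feasible. The linear constraints hold for them by an
  instance of Stokes' theorem that follows from scaling: with \<open>F = g\<^sub>1\<^sup>i g\<^sub>2\<^sup>j max h 0\<close>, which has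
  compact support, differentiate \<open>\<integral>F(t x) dx = t\<^sup>-\<^sup>n \<integral>F(x) dx\<close> at \<open>t = 1\<close> from both sides. As \<open>F\<close> is only
  Lipschitz, the zero set of \<open>h\<close> needs care: the case \<open>i = j = 0\<close> shows that the radial derivative
  of \<open>h\<close> vanishes almost everywhere on it.

  For convergence, write \<open>1 = s\<^sup>2 - h r\<^sup>2\<close> with continuous \<open>s\<close> and \<open>r\<close>, where \<open>s\<^sup>2\<close> is close to the
  indicator function of \<open>{h \<ge> 0}\<close>, and approximate \<open>s\<close> and \<open>r\<close> by polynomials uniformly on the
  support of \<open>\<Lambda>\<close>. Applying \<open>L\<close> bounds \<open>L(1)\<close> by \<open>\<integral>s\<^sup>2 d\<Lambda>\<close> up to a small error, for all large \<open>d\<close>.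
\<close>

section \<open>Riesz functionals and bivariate polynomials\<close>

text \<open>Cancellation can shrink the support of a sum, so sums over \<open>keys\<close> are
  compared on a common finite superset, where the extra coefficients are 0.\<close>

lemma sum_keys_superset:
  fixes p :: "'a \<Rightarrow>\<^sub>0 real"
  assumes "finite A" "Poly_Mapping.keys p \<subseteq> A"
  shows "(\<Sum>k\<in>Poly_Mapping.keys p. Poly_Mapping.lookup p k * f k) =
         (\<Sum>k\<in>A. Poly_Mapping.lookup p k * f k)"
  using assms by (intro sum.mono_neutral_left) (auto simp: in_keys_iff)

lemma sum_keys_add:
  fixes p q :: "'a \<Rightarrow>\<^sub>0 real"
  shows "(\<Sum>k\<in>Poly_Mapping.keys (p + q). Poly_Mapping.lookup (p + q) k * f k) =
         (\<Sum>k\<in>Poly_Mapping.keys p. Poly_Mapping.lookup p k * f k) +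
         (\<Sum>k\<in>Poly_Mapping.keys q. Poly_Mapping.lookup q k * f k)"
proof -
  let ?A = "Poly_Mapping.keys p \<union> Poly_Mapping.keys q"
  have "Poly_Mapping.keys (p + q) \<subseteq> ?A"
    by (rule Poly_Mapping.keys_add)
  then show ?thesis
    unfolding sum_keys_superset[OF _ \<open>Poly_Mapping.keys (p + q) \<subseteq> ?A\<close>, simplified]
    by (simp add: sum_keys_superset[of ?A p] sum_keys_superset[of ?A q] lookup_add
        distrib_right sum.distrib)
qed

lemma poly_mapping_eq_sum_single:
  fixes p :: "'a \<Rightarrow>\<^sub>0 'b::comm_monoid_add"
  shows "p = (\<Sum>k\<in>Poly_Mapping.keys p. Poly_Mapping.single k (Poly_Mapping.lookup p k))"
proof (rule poly_mapping_eqI)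
  fix k
  show "Poly_Mapping.lookup p k = Poly_Mapping.lookup
          (\<Sum>k\<in>Poly_Mapping.keys p. Poly_Mapping.single k (Poly_Mapping.lookup p k)) k"
    by (cases "k \<in> Poly_Mapping.keys p") (auto simp: lookup_sum lookup_single when_def in_keys_iff)
qed

lemma riesz_add: "riesz \<phi> (p + q) = riesz \<phi> p + riesz \<phi> q"
  unfolding riesz_def by (rule sum_keys_add)

lemma riesz_zero [simp]: "riesz \<phi> 0 = 0"
  by (simp add: riesz_def)

lemma riesz_single [simp]: "riesz \<phi> (Poly_Mapping.single \<alpha> c) = c * \<phi> \<alpha>"
  by (simp add: riesz_def)

lemma riesz_uminus: "riesz \<phi> (- p) = - riesz \<phi> p"
  using riesz_add[of \<phi> p "- p"] by simp

lemma riesz_diff: "riesz \<phi> (p - q) = riesz \<phi> p - riesz \<phi> q"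
  using riesz_add[of \<phi> p "- q"] by (simp add: riesz_uminus)

lemma riesz_sum: "riesz \<phi> (\<Sum>i\<in>I. p i) = (\<Sum>i\<in>I. riesz \<phi> (p i))"
  by (induction I rule: infinite_finite_induct) (auto simp: riesz_add)

lemma riesz_cong:
  assumes "\<And>\<alpha>. \<alpha> \<in> Poly_Mapping.keys p \<Longrightarrow> \<phi> \<alpha> = \<psi> \<alpha>"
  shows "riesz \<phi> p = riesz \<psi> p"
  using assms by (simp add: riesz_def)

lemma riesz_mult:
  "riesz \<phi> (p * q) = (\<Sum>\<alpha>\<in>Poly_Mapping.keys p. \<Sum>\<beta>\<in>Poly_Mapping.keys q.
     Poly_Mapping.lookup p \<alpha> * Poly_Mapping.lookup q \<beta> * \<phi> (\<alpha> + \<beta>))"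
proof -
  have "p * q = (\<Sum>\<alpha>\<in>Poly_Mapping.keys p. \<Sum>\<beta>\<in>Poly_Mapping.keys q.
     Poly_Mapping.single (\<alpha> + \<beta>) (Poly_Mapping.lookup p \<alpha> * Poly_Mapping.lookup q \<beta>))"
    by (subst (1) poly_mapping_eq_sum_single[of p], subst (1) poly_mapping_eq_sum_single[of q])
       (simp add: sum_product mult_single)
  then show ?thesis
    by (simp add: riesz_sum)
qed

section \<open>Supports and degree bounds\<close>

lemma finite_idx [simp]: "finite (idx d)"
proof (rule finite_subset)
  show "idx d \<subseteq> {..d} \<times> {..d}"
    by (auto simp: idx_def)
qed simp

lemma idx_mono: "d \<le> e \<Longrightarrow> idx d \<subseteq> idx e"
  by (auto simp: idx_def)

lemma zero_in_idx [simp]: "(0, 0) \<in> idx d"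
  by (simp add: idx_def)

lemma keys_add_idx:
  assumes "Poly_Mapping.keys p \<subseteq> idx d" "Poly_Mapping.keys q \<subseteq> idx d"
  shows "Poly_Mapping.keys (p + q) \<subseteq> idx d"
  using Poly_Mapping.keys_add[of p q] assms by blast

lemma keys_diff_idx:
  assumes "Poly_Mapping.keys p \<subseteq> idx d" "Poly_Mapping.keys q \<subseteq> idx d"
  shows "Poly_Mapping.keys (p - q :: bipoly) \<subseteq> idx d"
  using Poly_Mapping.keys_add[of p "- q"] assms by (auto simp: in_keys_iff)

lemma keys_mult_idx:
  assumes "Poly_Mapping.keys p \<subseteq> idx m" "Poly_Mapping.keys q \<subseteq> idx n"
  shows "Poly_Mapping.keys (p * q) \<subseteq> idx (m + n)"
  using keys_mult[of p q] assms by (force simp: idx_def)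

lemma keys_subset_idx_total_degree: "Poly_Mapping.keys (p :: bipoly) \<subseteq> idx (total_degree p)"
  by (auto simp: idx_def total_degree_def intro!: Max_ge)

section \<open>Semidefinite constraints as inequalities for the Riesz functional\<close>

text \<open>A vector indexed by \<open>idx d\<close> is the coefficient vector of a polynomial
  \<open>p\<close> supported there, and the quadratic form at this vector is the Riesz functional at
  \<open>p * p\<close>. Symmetry is automatic because entries depend only on the sum of the two
  indices.\<close>

lemma psd_moment_matrix_iff:
  "psd_on (idx d) (moment_matrix \<phi>) \<longleftrightarrow>
   (\<forall>p. Poly_Mapping.keys p \<subseteq> idx d \<longrightarrow> 0 \<le> riesz \<phi> (p * p))"
proof -
  have form: "(\<Sum>\<alpha>\<in>idx d. \<Sum>\<beta>\<in>idx d. v \<alpha> * moment_matrix \<phi> \<alpha> \<beta> * v \<beta>) = riesz \<phi> (p * p)"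
    if v: "\<And>\<alpha>. \<alpha> \<in> idx d \<Longrightarrow> v \<alpha> = Poly_Mapping.lookup p \<alpha>"
      and p: "Poly_Mapping.keys p \<subseteq> idx d" for p v
  proof -
    have "riesz \<phi> (p * p) = (\<Sum>\<alpha>\<in>Poly_Mapping.keys p. Poly_Mapping.lookup p \<alpha> *
        (\<Sum>\<beta>\<in>Poly_Mapping.keys p. Poly_Mapping.lookup p \<beta> * \<phi> (\<alpha> + \<beta>)))"
      by (simp add: riesz_mult sum_distrib_left mult.assoc)
    also have "\<dots> = (\<Sum>\<alpha>\<in>idx d. Poly_Mapping.lookup p \<alpha> *
        (\<Sum>\<beta>\<in>idx d. Poly_Mapping.lookup p \<beta> * \<phi> (\<alpha> + \<beta>)))"
      using p by (simp add: sum_keys_superset[of "idx d"])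
    also have "\<dots> = (\<Sum>\<alpha>\<in>idx d. \<Sum>\<beta>\<in>idx d. v \<alpha> * moment_matrix \<phi> \<alpha> \<beta> * v \<beta>)"
      by (simp add: sum_distrib_left v moment_matrix_def mult_ac)
    finally show ?thesis by simp
  qed
  show ?thesis
  proof
    assume "psd_on (idx d) (moment_matrix \<phi>)"
    then show "\<forall>p. Poly_Mapping.keys p \<subseteq> idx d \<longrightarrow> 0 \<le> riesz \<phi> (p * p)"
      unfolding psd_on_def by (auto simp flip: form[OF refl])
  next
    assume nonneg: "\<forall>p. Poly_Mapping.keys p \<subseteq> idx d \<longrightarrow> 0 \<le> riesz \<phi> (p * p)"
    show "psd_on (idx d) (moment_matrix \<phi>)"
      unfolding psd_on_def
    proof (intro conjI ballI allI)
      fix v :: "nat \<times> nat \<Rightarrow> real"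
      define p where "p = (\<Sum>\<alpha>\<in>idx d. Poly_Mapping.single \<alpha> (v \<alpha>))"
      have look: "Poly_Mapping.lookup p \<alpha> = (if \<alpha> \<in> idx d then v \<alpha> else 0)" for \<alpha>
        by (auto simp: p_def lookup_sum lookup_single when_def)
      then have "Poly_Mapping.keys p \<subseteq> idx d"
        by (auto simp: in_keys_iff split: if_splits)
      with form[of v p] nonneg look
      show "0 \<le> (\<Sum>\<alpha>\<in>idx d. \<Sum>\<beta>\<in>idx d. v \<alpha> * moment_matrix \<phi> \<alpha> \<beta> * v \<beta>)"
        by simp
    qed (simp add: moment_matrix_def add.commute)
  qed
qed

text \<open>Together with \<open>riesz_shift\<close> this lets \<open>psd_moment_matrix_iff\<close>
  handle the localizing constraint as well: shifting the sequence by \<open>h\<close> amounts to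
  multiplying the argument of the functional by \<open>h\<close>.\<close>

lemma localizing_matrix_eq_moment_matrix:
  "localizing_matrix h \<phi> = moment_matrix (\<lambda>\<delta>. riesz (\<lambda>\<gamma>. \<phi> (\<delta> + \<gamma>)) h)"
  by (simp add: fun_eq_iff localizing_matrix_def moment_matrix_def riesz_def)

lemma riesz_shift: "riesz (\<lambda>\<delta>. riesz (\<lambda>\<gamma>. \<phi> (\<delta> + \<gamma>)) h) p = riesz \<phi> (h * p)"
  unfolding mult.commute[of h p] riesz_mult by (simp add: riesz_def sum_distrib_left mult.assoc)

lemma riesz_fun_diff: "riesz (\<lambda>\<alpha>. \<phi> \<alpha> - \<psi> \<alpha>) p = riesz \<phi> p - riesz \<psi> p"
  by (simp add: riesz_def right_diff_distrib sum_subtractf)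

lemma rho_feasible_iff:
  "\<phi> \<in> rho_feasible a b \<mu> d \<longleftrightarrow>
     \<phi> \<in> idx (2 * d) \<rightarrow>\<^sub>E UNIV \<and>
     (\<forall>p. Poly_Mapping.keys p \<subseteq> idx d \<longrightarrow> 0 \<le> riesz \<phi> (p * p)) \<and>
     (\<forall>p. Poly_Mapping.keys p \<subseteq> idx d \<longrightarrow> riesz \<phi> (p * p) \<le> riesz (moments \<mu>) (p * p)) \<and>
     (\<forall>p. Poly_Mapping.keys p \<subseteq> idx (d - 1) \<longrightarrow> 0 \<le> riesz \<phi> (htilde a b * (p * p)))"
proof -
  have "(\<lambda>\<alpha> \<beta>. moment_matrix (moments \<mu>) \<alpha> \<beta> - moment_matrix \<phi> \<alpha> \<beta>) =
      moment_matrix (\<lambda>\<alpha>. moments \<mu> \<alpha> - \<phi> \<alpha>)"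
    by (simp add: fun_eq_iff moment_matrix_def)
  then show ?thesis
    by (simp add: rho_feasible_def loewner_le_def localizing_matrix_eq_moment_matrix
        psd_moment_matrix_iff riesz_shift riesz_fun_diff)
qed

section \<open>Evaluation and uniform approximation\<close>

text \<open>Evaluation at a point is the Riesz functional of the moments of the Dirac measure there,
  so additivity comes from \<open>riesz_add\<close> and multiplicativity from
  \<open>riesz_mult\<close>.\<close>

definition beval :: "bipoly \<Rightarrow> real \<times> real \<Rightarrow> real" where
  "beval p z = riesz (\<lambda>\<alpha>. fst z ^ fst \<alpha> * snd z ^ snd \<alpha>) p"

lemma beval_add [simp]: "beval (p + q) z = beval p z + beval q z"
  by (simp add: beval_def riesz_add)

lemma beval_diff [simp]: "beval (p - q) z = beval p z - beval q z"
  by (simp add: beval_def riesz_diff)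

lemma beval_mult [simp]: "beval (p * q) z = beval p z * beval q z"
  by (simp add: beval_def riesz_mult) (simp add: riesz_def sum_product power_add mult_ac)

lemma beval_cst [simp]: "beval (cst c) z = c"
  by (simp add: beval_def cst_def)

lemma beval_one [simp]: "beval 1 z = 1"
  by (simp add: beval_def flip: single_one)

lemma beval_power [simp]: "beval (p ^ k) z = beval p z ^ k"
  by (induction k) auto

lemma beval_z1 [simp]: "beval z1 z = fst z"
  by (simp add: beval_def z1_def)

lemma beval_z2 [simp]: "beval z2 z = snd z"
  by (simp add: beval_def z2_def)

lemma beval_htilde [simp]:
  "beval (htilde a b) z = (b - fst z - snd z) * (fst z + snd z - a)"
  by (simp add: htilde_def)

lemma beval_qpoly [simp]:
  "beval (qpoly n a b i j) z =
     real (n + i + 2 * j) * fst z ^ i * snd z ^ j * (b - fst z - snd z) * (fst z + snd z - a)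
     + (fst z + 2 * snd z) * fst z ^ i * snd z ^ j * (a + b - 2 * fst z - 2 * snd z)"
  by (simp add: qpoly_def)

lemma continuous_on_beval [continuous_intros]: "continuous_on A (beval p)"
  unfolding beval_def riesz_def by (intro continuous_intros)

lemma borel_measurable_beval [measurable]: "beval p \<in> borel_measurable borel"
  by (intro borel_measurable_continuous_onI continuous_on_beval)

text \<open>Connects Stone-Weierstrass, which yields polynomial functions, with the coefficient
  objects on which \<open>riesz\<close> acts. In the base case a linear functional on the plane is
  determined by its values at \<open>(1, 0)\<close> and \<open>(0, 1)\<close>.\<close>

lemma real_polynomial_function_imp_beval:
  fixes f :: "real \<times> real \<Rightarrow> real"
  assumes "real_polynomial_function f"
  shows "\<exists>p. f = beval p"
  using assms
proof (induction f rule: real_polynomial_function.induct)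
  case (linear f)
  interpret bounded_linear f by fact
  have f: "f (x, y) = x * f (1, 0) + y * f (0, 1)" for x y
  proof -
    have "f (x, y) = f (x *\<^sub>R (1, 0) + y *\<^sub>R (0, 1))"
      by simp
    also have "\<dots> = x * f (1, 0) + y * f (0, 1)"
      unfolding add scaleR real_scaleR_def ..
    finally show ?thesis .
  qed
  have "f z = beval (cst (f (1, 0)) * z1 + cst (f (0, 1)) * z2) z" for z
    using f[of "fst z" "snd z"] by (simp add: mult.commute)
  then show ?case by blast
next
  case (const c)
  have "(\<lambda>x. c) = beval (cst c)" by (simp add: fun_eq_iff)
  then show ?case by blast
next
  case (add f g)
  then obtain p q where "f = beval p" "g = beval q" by blast
  then have "(\<lambda>x. f x + g x) = beval (p + q)" by (simp add: fun_eq_iff)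
  then show ?case by blast
next
  case (mult f g)
  then obtain p q where "f = beval p" "g = beval q" by blast
  then have "(\<lambda>x. f x * g x) = beval (p * q)" by (simp add: fun_eq_iff)
  then show ?case by blast
qed

lemma beval_approximation:
  fixes f :: "real \<times> real \<Rightarrow> real"
  assumes "compact T" "continuous_on T f" "0 < e"
  obtains p where "\<And>z. z \<in> T \<Longrightarrow> \<bar>f z - beval p z\<bar> < e"
  using Stone_Weierstrass_real_polynomial_function[OF assms] real_polynomial_function_imp_beval
  by metis

lemma keys_htilde: "Poly_Mapping.keys (htilde a b) \<subseteq> idx 2"
proof -
  have "Poly_Mapping.keys (cst c) \<subseteq> idx 1" for c
    by (simp add: cst_def idx_def)
  moreover have "Poly_Mapping.keys z1 \<subseteq> idx 1" "Poly_Mapping.keys z2 \<subseteq> idx 1"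
    by (simp_all add: z1_def z2_def idx_def)
  ultimately have "Poly_Mapping.keys (htilde a b) \<subseteq> idx (1 + 1)"
    unfolding htilde_def by (intro keys_mult_idx keys_add_idx keys_diff_idx)
  then show ?thesis by (simp add: numeral_2_eq_2)
qed

lemma keys_square_idx:
  "Poly_Mapping.keys p \<subseteq> idx d \<Longrightarrow> Poly_Mapping.keys (p * p :: bipoly) \<subseteq> idx (2 * d)"
  using keys_mult_idx[of p d p d] by (simp add: mult_2)

lemma keys_htilde_square_idx:
  assumes "Poly_Mapping.keys p \<subseteq> idx (d - 1)" "1 \<le> d"
  shows "Poly_Mapping.keys (htilde a b * (p * p)) \<subseteq> idx (2 * d)"
proof -
  \<comment> \<open>This is where \<open>1 \<le> d\<close> matters: for \<open>d = 0\<close>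
    truncated subtraction gives \<open>d - 1 = 0\<close>, and the left side would be 2.\<close>
  have "2 + 2 * (d - 1) = 2 * d"
    using assms by simp
  then show ?thesis
    using keys_mult_idx[OF keys_htilde keys_square_idx[OF assms(1)]] by metis
qed

section \<open>Feasible sets\<close>

lemma continuous_on_riesz: "continuous_on UNIV (\<lambda>\<phi>. riesz \<phi> p)"
  unfolding riesz_def by (intro continuous_intros continuous_on_product_coordinates)

lemma idx_double_eq_add:
  assumes "\<gamma> \<in> idx (2 * d)"
  obtains \<alpha> \<beta> where "\<alpha> \<in> idx d" "\<beta> \<in> idx d" "\<gamma> = \<alpha> + \<beta>"
proof -
  obtain i j where \<gamma>: "\<gamma> = (i, j)" by (cases \<gamma>)
  \<comment> \<open>Fill the first summand greedily: as much of \<open>i\<close> as fits, then as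
    much of \<open>j\<close> as the remaining room allows.\<close>
  define k l where "k = min i d" and "l = min j (d - k)"
  have "(k, l) \<in> idx d" "(i - k, j - l) \<in> idx d" "\<gamma> = (k, l) + (i - k, j - l)"
    using assms by (auto simp: \<gamma> k_def l_def idx_def)
  then show thesis using that by blast
qed

text \<open>For the monomials \<open>p\<close> and \<open>q\<close> with exponents \<alpha> and
  \<beta>, nonnegativity of the functional at the squares of \<open>p + q\<close> and
  \<open>p - q\<close> bounds the mixed entry by the mean of the two diagonal entries. The upper
  matrix constraint bounds those by the moments of \<mu>.\<close>

lemma rho_feasible_bound:
  assumes "\<phi> \<in> rho_feasible a b \<mu> d" "\<alpha> \<in> idx d" "\<beta> \<in> idx d"
  shows "\<bar>\<phi> (\<alpha> + \<beta>)\<bar> \<le> (moments \<mu> (\<alpha> + \<alpha>) + moments \<mu> (\<beta> + \<beta>)) / 2"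
proof -
  define p q :: bipoly where "p = Poly_Mapping.single \<alpha> 1" and "q = Poly_Mapping.single \<beta> 1"
  have pq: "riesz \<phi> (p * p) = \<phi> (\<alpha> + \<alpha>)" "riesz \<phi> (q * q) = \<phi> (\<beta> + \<beta>)"
    "riesz \<phi> (p * q) = \<phi> (\<alpha> + \<beta>)" "riesz \<phi> (q * p) = \<phi> (\<alpha> + \<beta>)"
    "riesz (moments \<mu>) (p * p) = moments \<mu> (\<alpha> + \<alpha>)"
    "riesz (moments \<mu>) (q * q) = moments \<mu> (\<beta> + \<beta>)"
    by (simp_all add: p_def q_def mult_single add.commute)
  have keys: "Poly_Mapping.keys p \<subseteq> idx d" "Poly_Mapping.keys q \<subseteq> idx d"
    using assms by (auto simp: p_def q_def)
  have keys2: "Poly_Mapping.keys (p + q) \<subseteq> idx d" "Poly_Mapping.keys (p - q) \<subseteq> idx d"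
    using keys_add_idx[OF keys] keys_diff_idx[OF keys] .
  have "0 \<le> riesz \<phi> ((p + q) * (p + q))" "0 \<le> riesz \<phi> ((p - q) * (p - q))"
    "riesz \<phi> (p * p) \<le> riesz (moments \<mu>) (p * p)" "riesz \<phi> (q * q) \<le> riesz (moments \<mu>) (q * q)"
    using assms(1) keys keys2 unfolding rho_feasible_iff by blast+
  moreover have "\<bar>y\<bar> \<le> (m + n) / 2"
    if "0 \<le> x + y + (y + z)" "0 \<le> x - y - (y - z)" "x \<le> m" "z \<le> n" for x y z m n :: real
    using that unfolding abs_le_iff by (simp add: field_simps)
  ultimately show ?thesis
    unfolding ring_distribs riesz_add riesz_diff pq by blast
qed

text \<open>The coordinate bounds place the feasible set in a product of compact sets, compact by
  Tychonoff. The remaining constraints are closed in the product topology, as each reads only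
  finitely many coordinates.\<close>

lemma compact_rho_feasible: "compact (rho_feasible a b \<mu> d)"
proof -
  have "\<exists>B. \<forall>\<phi>\<in>rho_feasible a b \<mu> d. \<bar>\<phi> \<gamma>\<bar> \<le> B" if "\<gamma> \<in> idx (2 * d)" for \<gamma>
    using idx_double_eq_add[OF that] rho_feasible_bound by metis
  then obtain B where B: "\<And>\<gamma> \<phi>. \<gamma> \<in> idx (2 * d) \<Longrightarrow> \<phi> \<in> rho_feasible a b \<mu> d \<Longrightarrow> \<bar>\<phi> \<gamma>\<bar> \<le> B \<gamma>"
    by metis
  \<comment> \<open>Extensional functions equal \<open>undefined\<close> off the index set, hence
    the singleton factors there.\<close>
  define C where "C \<gamma> = (if \<gamma> \<in> idx (2 * d) then {- B \<gamma>..B \<gamma>} else {undefined})" for \<gamma>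
  define R where "R =
     {\<phi>. (\<forall>p. Poly_Mapping.keys p \<subseteq> idx d \<longrightarrow> 0 \<le> riesz \<phi> (p * p)) \<and>
     (\<forall>p. Poly_Mapping.keys p \<subseteq> idx d \<longrightarrow> riesz \<phi> (p * p) \<le> riesz (moments \<mu>) (p * p)) \<and>
     (\<forall>p. Poly_Mapping.keys p \<subseteq> idx (d - 1) \<longrightarrow> 0 \<le> riesz \<phi> (htilde a b * (p * p)))}"
  have eq: "rho_feasible a b \<mu> d = PiE UNIV C \<inter> R"
  proof (rule set_eqI)
    fix \<phi> :: "nat \<times> nat \<Rightarrow> real"
    have "\<phi> \<in> PiE UNIV C" if "\<phi> \<in> rho_feasible a b \<mu> d"
      using B[OF _ that] that by (fastforce simp: C_def rho_feasible_iff abs_le_iff)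
    moreover have "\<phi> \<in> idx (2 * d) \<rightarrow>\<^sub>E UNIV" if "\<phi> \<in> PiE UNIV C"
      using that by (auto simp: C_def PiE_iff extensional_def split: if_splits)
    ultimately show "\<phi> \<in> rho_feasible a b \<mu> d \<longleftrightarrow> \<phi> \<in> PiE UNIV C \<inter> R"
      by (auto simp: R_def rho_feasible_iff)
  qed
  have "compactin (product_topology (\<lambda>_. euclidean) UNIV) (PiE UNIV C)"
    unfolding compactin_PiE by (auto simp: C_def)
  then have "compact (PiE UNIV C)"
    by (simp add: euclidean_product_topology)
  moreover have "closed R"
    unfolding R_def
    by (intro closed_Collect_conj closed_Collect_all closed_Collect_imp closed_Collect_le
        continuous_on_riesz continuous_on_const open_Collect_const)
  ultimately show ?thesis
    unfolding eq by (rule compact_Int_closed)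
qed

lemma tau_feasible_subset: "tau_feasible n a b \<mu> d \<subseteq> rho_feasible a b \<mu> d"
  by (auto simp: tau_feasible_def)

lemma compact_tau_feasible: "compact (tau_feasible n a b \<mu> d)"
proof -
  have "closed {\<phi>. \<forall>i j. total_degree (qpoly n a b i j) \<le> 2 * d \<longrightarrow> riesz \<phi> (qpoly n a b i j) = 0}"
    by (intro closed_Collect_all closed_Collect_imp closed_Collect_eq
        continuous_on_riesz continuous_on_const open_Collect_const)
  moreover have "tau_feasible n a b \<mu> d = rho_feasible a b \<mu> d \<inter>
     {\<phi>. \<forall>i j. total_degree (qpoly n a b i j) \<le> 2 * d \<longrightarrow> riesz \<phi> (qpoly n a b i j) = 0}"
    by (auto simp: tau_feasible_def)
  ultimately show ?thesis
    using compact_rho_feasible by (simp add: compact_Int_closed)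
qed

section \<open>Attained maxima and truncation of sequences\<close>

lemma compact_is_arg_max_exists:
  fixes F :: "('i \<Rightarrow> real) set"
  assumes "compact F" "F \<noteq> {}"
  shows "\<exists>\<phi>. is_arg_max (\<lambda>\<phi>. \<phi> k) (\<lambda>\<phi>. \<phi> \<in> F) \<phi>"
proof -
  have "continuous_on F (\<lambda>\<phi>. \<phi> k)"
    by (rule continuous_on_subset[OF continuous_on_product_coordinates]) simp
  then obtain \<phi> where "\<phi> \<in> F" "\<forall>\<psi>\<in>F. \<psi> k \<le> \<phi> k"
    using continuous_attains_sup[OF assms] by metis
  then show ?thesis
    by (intro exI[of _ \<phi>]) (auto simp: is_arg_max_def not_less)
qed

lemma Greatest_image_eq:
  fixes f :: "'a \<Rightarrow> real"
  assumes "is_arg_max f (\<lambda>x. x \<in> F) x"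
  shows "(GREATEST v. v \<in> f ` F) = f x"
  using assms by (intro Greatest_equality) (auto simp: is_arg_max_def not_less)

lemma is_arg_max_ge:
  fixes f :: "'a \<Rightarrow> real"
  assumes "is_arg_max f (\<lambda>x. x \<in> F) x" "y \<in> F"
  shows "f y \<le> f x"
  using assms by (auto simp: is_arg_max_def not_less)

text \<open>Test polynomials of level \<open>d\<close> are also test polynomials of level
  \<open>e\<close>, and the constraints of level \<open>d\<close> read only coordinates in
  \<open>idx (2 * d)\<close>. The version for \<open>tau_feasible\<close> below gives monotonicity
  in \<open>d\<close>.\<close>

lemma restrict_rho_feasible:
  assumes "\<phi> \<in> rho_feasible a b \<mu> e" "1 \<le> d" "d \<le> e"
  shows "restrict \<phi> (idx (2 * d)) \<in> rho_feasible a b \<mu> d"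
proof -
  have riesz: "riesz (restrict \<phi> (idx (2 * d))) q = riesz \<phi> q" if "Poly_Mapping.keys q \<subseteq> idx (2 * d)" for q
    using that by (intro riesz_cong) auto
  have "idx d \<subseteq> idx e" "idx (d - 1) \<subseteq> idx (e - 1)"
    using assms by (auto intro!: idx_mono)
  then show ?thesis
    using assms(1) unfolding rho_feasible_iff
    by (auto simp: riesz[OF keys_square_idx] riesz[OF keys_htilde_square_idx[OF _ \<open>1 \<le> d\<close>]])
qed

lemma restrict_tau_feasible:
  assumes "\<phi> \<in> tau_feasible n a b \<mu> e" "1 \<le> d" "d \<le> e"
  shows "restrict \<phi> (idx (2 * d)) \<in> tau_feasible n a b \<mu> d"
proof -
  have "riesz (restrict \<phi> (idx (2 * d))) (qpoly n a b i j) = 0"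
    if "total_degree (qpoly n a b i j) \<le> 2 * d" for i j
  proof -
    have "riesz (restrict \<phi> (idx (2 * d))) (qpoly n a b i j) = riesz \<phi> (qpoly n a b i j)"
      using keys_subset_idx_total_degree idx_mono[OF that] by (intro riesz_cong) auto
    then show ?thesis
      using assms that by (auto simp: tau_feasible_def)
  qed
  then show ?thesis
    using assms restrict_rho_feasible by (auto simp: tau_feasible_def)
qed

section \<open>Probability measures carried by a compact set, and their moments\<close>

locale compactly_supported = finite_measure M for M :: "(real \<times> real) measure" +
  fixes T :: "(real \<times> real) set"
  assumes sets_M [measurable_cong]: "sets M = sets borel"
    and mass_one: "measure M UNIV = 1"
    and compact_T: "compact T"
    and AE_T: "AE z in M. z \<in> T"
begin

lemma space_M [simp]: "space M = UNIV"
  using sets_eq_imp_space_eq[OF sets_M] by simp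

lemma integrable_continuous_on_T:
  assumes "continuous_on T f" "f \<in> borel_measurable borel"
  shows "integrable M (f :: _ \<Rightarrow> real)"
proof -
  have "bounded (f ` T)"
    using assms compact_T by (intro compact_imp_bounded compact_continuous_image)
  then obtain B where "\<And>z. z \<in> T \<Longrightarrow> norm (f z) \<le> B"
    by (auto simp: bounded_iff)
  with AE_T have "AE z in M. norm (f z) \<le> B"
    by auto
  then show ?thesis
    using assms by (intro integrable_const_bound) (auto simp: measurable_cong_sets[OF sets_M refl])
qed

lemma integrable_beval [simp, intro]: "integrable M (beval p)"
  by (intro integrable_continuous_on_T continuous_intros) measurable

lemma integrable_indicator_beval [simp, intro]:
  assumes "A \<in> sets borel"
  shows "integrable M (\<lambda>z. indicator A z * beval p z)"
  using integrable_real_mult_indicator[OF _ integrable_beval, of A p] assms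
  by (simp add: sets_M mult.commute)

definition moments_on :: "(real \<times> real) set \<Rightarrow> nat \<times> nat \<Rightarrow> real" where
  "moments_on A \<alpha> = (LINT z|M. indicator A z * (fst z ^ fst \<alpha> * snd z ^ snd \<alpha>))"

lemma riesz_moments_on:
  assumes "A \<in> sets borel"
  shows "riesz (moments_on A) p = (LINT z|M. indicator A z * beval p z)"
proof -
  have "integrable M (\<lambda>z. indicator A z * (fst z ^ fst \<alpha> * snd z ^ snd \<alpha>))" for \<alpha> :: "nat \<times> nat"
    using integrable_indicator_beval[OF assms, of "Poly_Mapping.single \<alpha> 1"] by (simp add: beval_def)
  then have "riesz (moments_on A) p = (LINT z|M. (\<Sum>\<alpha>\<in>Poly_Mapping.keys p.
      Poly_Mapping.lookup p \<alpha> * (indicator A z * (fst z ^ fst \<alpha> * snd z ^ snd \<alpha>))))"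
    by (simp add: riesz_def moments_on_def)
  also have "\<dots> = (LINT z|M. indicator A z * beval p z)"
    by (intro Bochner_Integration.integral_cong refl)
       (simp only: beval_def riesz_def sum_distrib_left mult.left_commute)
  finally show ?thesis .
qed

lemma riesz_moments: "riesz (moments M) p = (LINT z|M. beval p z)"
proof -
  have "moments M = moments_on UNIV"
    by (simp add: fun_eq_iff moments_on_def moments_def)
  then show ?thesis
    by (simp add: riesz_moments_on)
qed

text \<open>All three constraints integrate pointwise inequalities: the square of \<open>p\<close>
  times the indicator of \<open>A\<close> lies between 0 and that square, and
  \<open>htilde a b\<close> is nonnegative on \<open>A\<close>.\<close>

lemma moments_on_feasible:
  assumes A: "A \<in> sets borel" "\<And>z. z \<in> A \<Longrightarrow> a \<le> fst z + snd z \<and> fst z + snd z \<le> b" and "1 \<le> d"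
  shows "restrict (moments_on A) (idx (2 * d)) \<in> rho_feasible a b M d"
proof -
  have riesz: "riesz (restrict (moments_on A) (idx (2 * d))) q = riesz (moments_on A) q"
    if "Poly_Mapping.keys q \<subseteq> idx (2 * d)" for q
    using that by (intro riesz_cong) auto
  have "0 \<le> (LINT z|M. indicator A z * beval (p * p) z)" for p
    by (intro Bochner_Integration.integral_nonneg) simp
  moreover have "(LINT z|M. indicator A z * beval (p * p) z) \<le> (LINT z|M. beval (p * p) z)" for p
    using A(1) by (intro integral_mono integrable_indicator_beval integrable_beval)
      (auto split: split_indicator)
  moreover have "0 \<le> (LINT z|M. indicator A z * beval (htilde a b * (p * p)) z)" for p
  proof (intro Bochner_Integration.integral_nonneg)
    fix z
    show "0 \<le> indicator A z * beval (htilde a b * (p * p)) z"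
      using A(2)[of z] by (cases "z \<in> A") simp_all
  qed
  ultimately show ?thesis
    unfolding rho_feasible_iff by (simp add: riesz[OF keys_square_idx] riesz[OF keys_htilde_square_idx[OF _ \<open>1 \<le> d\<close>]]
        riesz_moments_on A riesz_moments del: beval_mult beval_htilde)
qed

lemma moments_on_0: "A \<in> sets borel \<Longrightarrow> moments_on A (0, 0) = measure M A"
  by (simp add: moments_on_def sets_M)

end

section \<open>The upper bound\<close>

text \<open>
  With \<open>m\<close> the negative part of \<open>h\<close>, take \<open>r\<^sup>2 = k\<^sup>2 m / max 1 (k m)\<^sup>2\<close>. Since \<open>r\<close> vanishes where
  \<open>h \<ge> 0\<close>, one gets \<open>1 + h r\<^sup>2 = 1 - min 1 (k m)\<^sup>2 \<ge> 0\<close>, which is \<open>s\<^sup>2\<close>.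
\<close>

lemma square_decomposition:
  fixes h :: "'a::topological_space \<Rightarrow> real" and k :: nat
  assumes "continuous_on UNIV h"
  obtains s r where "continuous_on UNIV s" "continuous_on UNIV r"
    "\<And>z. 1 = (s z)\<^sup>2 - h z * (r z)\<^sup>2"
    "\<And>z. (s z)\<^sup>2 = 1 - min 1 ((real k * max 0 (- h z))\<^sup>2)"
proof -
  define m where "m z = max 0 (- h z)" for z
  define p where "p z = (real k)\<^sup>2 * m z / max 1 ((real k * m z)\<^sup>2)" for z
  define w where "w z = 1 - min 1 ((real k * m z)\<^sup>2)" for z
  have cont: "continuous_on UNIV m"
    unfolding m_def by (intro continuous_intros assms)
  have max: "max 1 x \<noteq> 0" for x :: real
    by (simp add: max_def)
  have "continuous_on UNIV (\<lambda>z. sqrt (w z))" "continuous_on UNIV (\<lambda>z. sqrt (p z))"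
    unfolding w_def p_def by (intro continuous_intros cont; simp add: max)+
  moreover have w: "(sqrt (w z))\<^sup>2 = w z" for z
    by (simp add: w_def)
  moreover have "1 = (sqrt (w z))\<^sup>2 - h z * (sqrt (p z))\<^sup>2" for z
  proof -
    have p: "(sqrt (p z))\<^sup>2 = p z"
      by (simp add: p_def m_def)
    have "h z * p z = - (m z * p z)"
      by (simp add: p_def m_def max_def)
    also have "m z * p z = (real k * m z)\<^sup>2 / max 1 ((real k * m z)\<^sup>2)"
      by (simp add: p_def power2_eq_square)
    also have "\<dots> = min 1 ((real k * m z)\<^sup>2)"
      by (auto simp: max_def min_def)
    finally show ?thesis
      unfolding w p by (simp add: w_def)
  qed
  ultimately show thesis
    using that[of "\<lambda>z. sqrt (w z)" "\<lambda>z. sqrt (p z)"] by (simp add: w_def m_def)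
qed

lemma abs_diff_squares_le:
  fixes x y :: real
  assumes "\<bar>x - y\<bar> < e" "e \<le> 1" "\<bar>x\<bar> \<le> C"
  shows "\<bar>x\<^sup>2 - y\<^sup>2\<bar> \<le> e * (2 * C + 1)"
proof -
  have "x\<^sup>2 - y\<^sup>2 = (x - y) * (x + y)"
    by (simp add: power2_eq_square algebra_simps)
  then have "\<bar>x\<^sup>2 - y\<^sup>2\<bar> = \<bar>x - y\<bar> * \<bar>x + y\<bar>"
    by (simp add: abs_mult)
  also have "\<dots> \<le> e * (2 * C + 1)"
    using assms by (intro mult_mono) auto
  finally show ?thesis .
qed

context compactly_supported
begin

lemma rho_feasible_upper:
  assumes "a \<le> b" "0 < \<epsilon>"
  defines "A \<equiv> {z. a \<le> fst z + snd z \<and> fst z + snd z \<le> b}"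
  shows "\<exists>D. \<forall>d\<ge>D. \<forall>\<phi>\<in>rho_feasible a b M d. \<phi> (0, 0) \<le> measure M A + \<epsilon>"
proof -
  define h where "h = beval (htilde a b)"
  have h: "continuous_on UNIV h" and [measurable]: "h \<in> borel_measurable borel"
    unfolding h_def by (rule continuous_on_beval, rule borel_measurable_beval)
  \<comment> \<open>Because \<open>a \<le> b\<close>, the two factors of \<open>h\<close> cannot
    both be negative.\<close>
  have A: "z \<in> A \<longleftrightarrow> 0 \<le> h z" for z
    using \<open>a \<le> b\<close> by (auto simp: A_def h_def zero_le_mult_iff)
  have [measurable]: "A \<in> sets borel"
    unfolding A_def by (intro borel_closed closed_Collect_conj closed_Collect_le continuous_intros)
  define u where "u k z = 1 - min 1 ((real k * max 0 (- h z))\<^sup>2)" for k z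
  have "continuous_on UNIV (u k)" for k
    unfolding u_def by (intro continuous_intros h)
  then have u: "integrable M (u k)" for k
    by (auto intro: integrable_continuous_on_T continuous_on_subset borel_measurable_continuous_onI)
  \<comment> \<open>\<open>u k\<close> is 1 on \<open>A\<close>; off \<open>A\<close> the
    Archimedean property makes it exactly 0 from some \<open>k\<close> on. The constant 1
    dominates.\<close>
  have "(\<lambda>k. LINT z|M. u k z) \<longlonglongrightarrow> (LINT z|M. indicator A z)"
  proof (rule integral_dominated_convergence[where w = "\<lambda>_. 1"])
    show "AE z in M. (\<lambda>k. u k z) \<longlonglongrightarrow> indicator A z"
    proof (intro AE_I2)
      fix z
      show "(\<lambda>k. u k z) \<longlonglongrightarrow> indicator A z"
      proof (cases "z \<in> A")
        case True
        then have "u k z = indicator A z" for k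
          using A[of z] by (simp add: u_def)
        then show ?thesis by simp
      next
        case False
        then have "h z < 0" using A[of z] by simp
        then obtain N where N: "1 < real N * (- h z)"
          using reals_Archimedean3[of "- h z"] by (metis neg_0_less_iff_less)
        have "u k z = indicator A z" if "N \<le> k" for k
        proof -
          have "1 \<le> real k * (- h z)"
            using N that \<open>h z < 0\<close> mult_right_mono[of "real N" "real k" "- h z"] by linarith
          then have "1 \<le> (real k * (- h z))\<^sup>2"
            by (metis one_le_power)
          then show ?thesis using False \<open>h z < 0\<close> by (simp add: u_def)
        qed
        then have "\<forall>\<^sub>F k in sequentially. u k z = indicator A z"
          by (auto simp: eventually_sequentially)
        then show ?thesis by (rule tendsto_eventually)
      qed
    qed
  qed (auto simp: u_def)
  then have "(\<lambda>k. LINT z|M. u k z) \<longlonglongrightarrow> measure M A"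
    by simp
  then have "\<forall>\<^sub>F k in sequentially. (LINT z|M. u k z) < measure M A + \<epsilon> / 3"
    using \<open>0 < \<epsilon>\<close> by (intro order_tendstoD(2)) auto
  then obtain k where k: "(LINT z|M. u k z) < measure M A + \<epsilon> / 3"
    by (meson eventually_sequentially order_refl)
  obtain s r where sr: "continuous_on UNIV s" "continuous_on UNIV r"
      "\<And>z. 1 = (s z)\<^sup>2 - h z * (r z)\<^sup>2" "\<And>z. (s z)\<^sup>2 = u k z"
    using square_decomposition[OF h, of k] unfolding u_def by metis
  have "bounded (h ` T)" "bounded (s ` T)" "bounded (r ` T)"
    using h sr compact_T
    by (auto intro!: compact_imp_bounded compact_continuous_image intro: continuous_on_subset)
  then have "bounded (h ` T \<union> s ` T \<union> r ` T)"
    by simp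
  then obtain C' where "\<forall>x\<in>h ` T \<union> s ` T \<union> r ` T. \<bar>x\<bar> \<le> C'"
    by (auto simp: bounded_iff)
  then have "\<exists>C\<ge>1. \<forall>x\<in>h ` T \<union> s ` T \<union> r ` T. \<bar>x\<bar> \<le> C"
    by (intro exI[of _ "max 1 C'"]) (auto simp: le_max_iff_disj)
  then obtain C where C: "1 \<le> C" "\<And>z. z \<in> T \<Longrightarrow> \<bar>h z\<bar> \<le> C"
    "\<And>z. z \<in> T \<Longrightarrow> \<bar>s z\<bar> \<le> C" "\<And>z. z \<in> T \<Longrightarrow> \<bar>r z\<bar> \<le> C"
    by blast
  \<comment> \<open>Approximating \<open>s\<close> and \<open>r\<close> within \<delta> costs
    \<open>\<delta> * (2 * C + 1)\<close> for each square, and the second square is multiplied by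
    \<open>h\<close>, bounded by \<open>C\<close>. The total is
    \<open>\<delta> * ((C + 1) * (2 * C + 1))\<close>; the cap at 1 serves
    \<open>abs_diff_squares_le\<close>.\<close>
  define \<delta> where "\<delta> = min 1 (\<epsilon> / 3 / ((C + 1) * (2 * C + 1)))"
  have pos: "0 < (C + 1) * (2 * C + 1)" using C(1) by simp
  have \<delta>: "0 < \<delta>" "\<delta> \<le> 1"
    using \<open>0 < \<epsilon>\<close> pos unfolding \<delta>_def by (auto simp: divide_pos_pos)
  have "\<delta> \<le> \<epsilon> / 3 / ((C + 1) * (2 * C + 1))" by (simp add: \<delta>_def)
  then have \<delta>': "\<delta> * ((C + 1) * (2 * C + 1)) \<le> \<epsilon> / 3"
    using pos by (simp add: pos_le_divide_eq)
  obtain \<sigma> where \<sigma>: "\<And>z. z \<in> T \<Longrightarrow> \<bar>s z - beval \<sigma> z\<bar> < \<delta>"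
    using beval_approximation[OF compact_T continuous_on_subset[OF sr(1)] \<delta>(1)] by auto
  obtain \<rho> where \<rho>: "\<And>z. z \<in> T \<Longrightarrow> \<bar>r z - beval \<rho> z\<bar> < \<delta>"
    using beval_approximation[OF compact_T continuous_on_subset[OF sr(2)] \<delta>(1)] by auto
  \<comment> \<open>The residual that turns the decomposition of 1 into an exact identity between
    polynomials, to which the functional can be applied. It is at most \<open>\<epsilon> / 3\<close>
    in absolute value on \<open>T\<close>.\<close>
  define e where "e = 1 - \<sigma> * \<sigma> + htilde a b * (\<rho> * \<rho>)"
  have s2: "\<bar>(s z)\<^sup>2 - (beval \<sigma> z)\<^sup>2\<bar> \<le> \<delta> * (2 * C + 1)" if "z \<in> T" for z
    using abs_diff_squares_le[OF \<sigma>[OF that] \<delta>(2) C(3)[OF that]] .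
  have r2: "\<bar>(r z)\<^sup>2 - (beval \<rho> z)\<^sup>2\<bar> \<le> \<delta> * (2 * C + 1)" if "z \<in> T" for z
    using abs_diff_squares_le[OF \<rho>[OF that] \<delta>(2) C(4)[OF that]] .
  have s3: "(beval \<sigma> z)\<^sup>2 \<le> u k z + \<epsilon> / 3" if "z \<in> T" for z
  proof -
    have "\<delta> * (2 * C + 1) \<le> \<delta> * ((C + 1) * (2 * C + 1))"
      using \<delta>(1) C(1) by (intro mult_left_mono) auto
    then show ?thesis using s2[OF that] \<delta>' sr(4)[of z] by linarith
  qed
  have e: "\<bar>beval e z\<bar> \<le> \<epsilon> / 3" if "z \<in> T" for z
  proof -
    have "beval e z = ((s z)\<^sup>2 - (beval \<sigma> z)\<^sup>2) - h z * ((r z)\<^sup>2 - (beval \<rho> z)\<^sup>2)"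
      using sr(3)[of z] by (simp add: e_def h_def power2_eq_square right_diff_distrib del: beval_htilde)
    then have "\<bar>beval e z\<bar> \<le> \<bar>(s z)\<^sup>2 - (beval \<sigma> z)\<^sup>2\<bar> + \<bar>h z\<bar> * \<bar>(r z)\<^sup>2 - (beval \<rho> z)\<^sup>2\<bar>"
      by (metis abs_mult abs_triangle_ineq4)
    also have "\<dots> \<le> \<delta> * (2 * C + 1) + C * (\<delta> * (2 * C + 1))"
      using C that s2 r2 by (intro add_mono mult_mono) auto
    also have "\<dots> = \<delta> * ((C + 1) * (2 * C + 1))" by (simp add: algebra_simps)
    finally show ?thesis using \<delta>' by linarith
  qed
  \<comment> \<open>The successor leaves room for \<rho> in \<open>idx (d - 1)\<close>, the index
    set of the localizing constraint.\<close>
  define D where "D = Suc (total_degree \<sigma> + total_degree \<rho> + total_degree e)"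
  show ?thesis
  proof (intro exI[of _ D] allI impI ballI)
    fix d \<phi> assume "D \<le> d" and \<phi>: "\<phi> \<in> rho_feasible a b M d"
    have keys: "Poly_Mapping.keys \<sigma> \<subseteq> idx d" "Poly_Mapping.keys e \<subseteq> idx d"
      "Poly_Mapping.keys \<rho> \<subseteq> idx (d - 1)"
      using \<open>D \<le> d\<close> by (auto simp: D_def
        intro!: order_trans[OF keys_subset_idx_total_degree idx_mono])
    have keys1: "Poly_Mapping.keys (cst c) \<subseteq> idx d" for c
      by (simp add: cst_def)
    have pos: "0 \<le> riesz \<phi> (p * p)" and upper: "riesz \<phi> (p * p) \<le> (LINT z|M. beval (p * p) z)"
      if "Poly_Mapping.keys p \<subseteq> idx d" for p
      using \<phi> that by (simp_all add: rho_feasible_iff riesz_moments)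
    have cst: "riesz \<phi> (cst c * p) = c * riesz \<phi> p" for c p
      unfolding cst_def riesz_mult by (simp add: riesz_def sum_distrib_left mult.assoc flip: zero_prod_def)
    have cst0: "riesz \<phi> (cst c) = c * \<phi> (0, 0)" for c
      by (simp add: cst_def)
    have one: "riesz \<phi> 1 = \<phi> (0, 0)"
      by (simp flip: single_one add: zero_prod_def)
    have "\<phi> (0, 0) = riesz \<phi> (\<sigma> * \<sigma>) - riesz \<phi> (htilde a b * (\<rho> * \<rho>)) + riesz \<phi> e"
      unfolding e_def by (simp add: riesz_add riesz_diff one)
    moreover have "0 \<le> riesz \<phi> (htilde a b * (\<rho> * \<rho>))"
      using \<phi> keys(3) by (simp add: rho_feasible_iff)
    moreover have "riesz \<phi> (\<sigma> * \<sigma>) \<le> measure M A + 2 * (\<epsilon> / 3)"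
    proof -
      have "riesz \<phi> (\<sigma> * \<sigma>) \<le> (LINT z|M. beval (\<sigma> * \<sigma>) z)" by (rule upper[OF keys(1)])
      also have "\<dots> \<le> (LINT z|M. u k z + \<epsilon> / 3)"
      proof (rule integral_mono_AE)
        show "integrable M (\<lambda>z. u k z + \<epsilon> / 3)"
          by (simp add: u)
        show "AE z in M. beval (\<sigma> * \<sigma>) z \<le> u k z + \<epsilon> / 3"
          using AE_T s3 by (auto simp: power2_eq_square)
      qed (rule integrable_beval)
      also have "\<dots> = (LINT z|M. u k z) + \<epsilon> / 3"
        by (simp add: u mass_one)
      finally show ?thesis using k by linarith
    qed
    \<comment> \<open>A feasible \<phi> need not come from a measure, so smallness of
      \<open>e\<close> on \<open>T\<close> does not bound \<open>riesz \<phi> e\<close> directly.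
      Only \<open>riesz \<phi> (e * e)\<close> is bounded by an integral; with
      \<open>c = \<epsilon> / 3\<close>, nonnegativity at the square of \<open>c - e\<close> then
      bounds \<open>riesz \<phi> e\<close>.\<close>
    moreover have "riesz \<phi> e \<le> \<epsilon> / 3"
    proof -
      let ?c = "\<epsilon> / 3"
      have "\<phi> (0, 0) \<le> 1"
        using upper[OF keys1[of 1]] by (simp add: cst cst0 mass_one)
      have "riesz \<phi> (e * e) \<le> (LINT z|M. beval (e * e) z)" by (rule upper[OF keys(2)])
      also have "\<dots> \<le> (LINT z|M. ?c\<^sup>2)"
      proof (rule integral_mono_AE)
        have "beval (e * e) z \<le> ?c\<^sup>2" if "z \<in> T" for z
          using e[OF that] by (simp flip: power2_eq_square add: abs_le_square_iff[symmetric])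
        with AE_T show "AE z in M. beval (e * e) z \<le> ?c\<^sup>2" by auto
      qed (rule integrable_beval, simp)
      finally have "riesz \<phi> (e * e) \<le> ?c\<^sup>2" by (simp add: mass_one)
      moreover have "0 \<le> riesz \<phi> ((cst ?c - e) * (cst ?c - e))"
        by (intro pos keys_diff_idx keys1 keys)
      then have "2 * ?c * riesz \<phi> e \<le> ?c\<^sup>2 * \<phi> (0, 0) + riesz \<phi> (e * e)"
        unfolding ring_distribs riesz_diff mult.commute[of e "cst _"] cst cst0
        by (simp add: power2_eq_square)
      moreover have "?c\<^sup>2 * \<phi> (0, 0) \<le> ?c\<^sup>2 * 1"
        using \<open>\<phi> (0, 0) \<le> 1\<close> by (intro mult_left_mono) auto
      ultimately have "2 * ?c * riesz \<phi> e \<le> 2 * ?c * ?c"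
        by (simp add: power2_eq_square)
      then show ?thesis
        using \<open>0 < \<epsilon>\<close> by simp
    qed
    ultimately show "\<phi> (0, 0) \<le> measure M A + \<epsilon>" by linarith
  qed
qed

end

section \<open>Stokes by scaling\<close>

lemma peval_add: "peval (p + q) x = peval p x + peval q x"
  unfolding peval_def by (rule sum_keys_add)

lemma continuous_on_peval [continuous_intros]: "continuous_on A (peval p)"
  unfolding peval_def by (intro continuous_intros)

lemma peval_scaleR:
  assumes "homogeneous k p"
  shows "peval p (t *\<^sub>R x) = t ^ k * peval p x"
proof -
  have "(\<Prod>i\<in>UNIV. ((t *\<^sub>R x) $ i) ^ Poly_Mapping.lookup m i) =
        t ^ k * (\<Prod>i\<in>UNIV. (x $ i) ^ Poly_Mapping.lookup m i)" if "m \<in> Poly_Mapping.keys p" for m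
    using assms that by (simp add: power_mult_distrib prod.distrib homogeneous_def flip: power_sum)
  then show ?thesis
    by (simp add: peval_def sum_distrib_left mult.left_commute)
qed

lemma integral_lborel_scaleR:
  fixes f :: "'a::euclidean_space \<Rightarrow> real"
  assumes "f \<in> borel_measurable borel" "0 < t"
  shows "(LINT x|lborel. f x) = t ^ DIM('a) * (LINT x|lborel. f (t *\<^sub>R x))"
proof -
  have "(LINT x|lborel. f x) = (LINT x|density (distr lborel borel (\<lambda>x. 0 + t *\<^sub>R x)) (\<lambda>_. \<bar>t\<bar> ^ DIM('a)). f x)"
    using lborel_affine[of t "0 :: 'a"] assms(2) by simp
  also have "\<dots> = t ^ DIM('a) * (LINT x|lborel. f (t *\<^sub>R x))"
    using assms by (subst integral_density) (auto simp: integral_distr)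
  finally show ?thesis .
qed

text \<open>The sign \<open>sg\<close> records the side from which \<open>t\<close> tends to 1. If
  \<open>H 1\<close> is nonzero, its sign persists nearby, so the positive part is locally
  \<open>H\<close> or 0. If \<open>H 1 = 0\<close>, the limit depends on the side.\<close>

lemma one_sided_derivative_max_0:
  fixes H :: "real \<Rightarrow> real" and t :: "nat \<Rightarrow> real"
  assumes H: "(H has_field_derivative D) (at 1)" and t: "t \<longlonglongrightarrow> 1"
    and sg: "\<And>k. 0 < sg * (t k - 1)" "\<bar>sg\<bar> = 1"
  shows "(\<lambda>k. (max (H (t k)) 0 - max (H 1) 0) / (t k - 1)) \<longlonglongrightarrow>
     (if 0 < H 1 then D else if H 1 = 0 then sg * max (sg * D) 0 else 0)"
proof -
  have ne: "t k \<noteq> 1" for k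
    using sg(1)[of k] by auto
  have "((\<lambda>y. (H y - H 1) / (y - 1)) \<longlongrightarrow> D) (at 1)"
    using H by (simp add: has_field_derivative_iff)
  moreover have "filterlim t (at 1) sequentially"
    using t ne by (simp add: filterlim_at)
  ultimately have quot: "(\<lambda>k. (H (t k) - H 1) / (t k - 1)) \<longlonglongrightarrow> D"
    by (rule filterlim_compose)
  have "isCont H 1"
    using H DERIV_isCont by blast
  then have lim: "(\<lambda>k. H (t k)) \<longlonglongrightarrow> H 1"
    using t by (rule isCont_tendsto_compose)
  consider "0 < H 1" | "H 1 = 0" | "H 1 < 0" by linarith
  then show ?thesis
  proof cases
    case 1
    with lim have "\<forall>\<^sub>F k in sequentially. 0 < H (t k)"
      by (rule order_tendstoD)
    then have "\<forall>\<^sub>F k in sequentially.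
        (max (H (t k)) 0 - max (H 1) 0) / (t k - 1) = (H (t k) - H 1) / (t k - 1)"
      using 1 by (auto elim!: eventually_mono)
    from tendsto_cong[OF this] show ?thesis
      using quot 1 by simp
  next
    case 2
    have sg2: "sg * sg = 1"
      using sg(2) by (metis abs_mult_self_eq mult_1)
    \<comment> \<open>Division by the positive number \<open>sg * (t k - 1)\<close> commutes with
      \<open>max\<close>; \<open>sg * sg = 1\<close> then removes the auxiliary sign.\<close>
    have "max (H (t k)) 0 / (t k - 1) = sg * max (sg * (H (t k) / (t k - 1))) 0" for k
    proof -
      have "max (H (t k)) 0 / (sg * (t k - 1)) = max (H (t k) / (sg * (t k - 1))) (0 / (sg * (t k - 1)))"
        using sg(1)[of k] by (intro max_divide_distrib_right[THEN trans]) simp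
      then have "sg * (max (H (t k)) 0 / (sg * (t k - 1))) = sg * max (H (t k) / (sg * (t k - 1))) 0"
        by simp
      moreover have "x / (sg * (t k - 1)) = sg * (x / (t k - 1))" for x
        using sg(1)[of k] sg2 ne[of k] by (simp add: divide_simps)
      ultimately show ?thesis
        using sg2 by (simp flip: mult.assoc)
    qed
    moreover have "(\<lambda>k. sg * max (sg * (H (t k) / (t k - 1))) 0) \<longlonglongrightarrow> sg * max (sg * D) 0"
      using quot 2 by (intro tendsto_intros) simp
    ultimately show ?thesis
      using 2 by simp
  next
    case 3
    with lim have "\<forall>\<^sub>F k in sequentially. H (t k) < 0"
      by (rule order_tendstoD)
    then have "\<forall>\<^sub>F k in sequentially. (max (H (t k)) 0 - max (H 1) 0) / (t k - 1) = 0"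
      using 3 by (auto elim!: eventually_mono)
    from tendsto_eventually[OF this] show ?thesis
      using 3 by simp
  qed
qed

text \<open>The function \<open>F\<close> of the scaling argument in terms of the values of the two
  forms, so that dilating the point by \<open>t\<close> replaces \<open>u\<close> by
  \<open>t * u\<close> and \<open>v\<close> by \<open>t\<^sup>2 * v\<close>.\<close>

definition bump :: "nat \<Rightarrow> nat \<Rightarrow> real \<Rightarrow> real \<Rightarrow> real \<Rightarrow> real \<Rightarrow> real" where
  "bump i j a b u v = u ^ i * v ^ j * max ((b - (u + v)) * (u + v - a)) 0"

text \<open>The derivative of \<open>h\<close> at \<open>t = 1\<close> along the curve
  \<open>t \<mapsto> (t * u, t\<^sup>2 * v)\<close>.\<close>

definition hderiv :: "real \<Rightarrow> real \<Rightarrow> real \<Rightarrow> real \<Rightarrow> real" where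
  "hderiv a b u v = (u + 2 * v) * (a + b - 2 * (u + v))"

text \<open>
  The one-sided derivative of \<open>t \<mapsto> bump i j a b (t u) (t\<^sup>2 v)\<close> at \<open>t = 1\<close>: the right one for
  \<open>sg = 1\<close>, the left one for \<open>sg = -1\<close>.
\<close>

definition dbump :: "real \<Rightarrow> nat \<Rightarrow> nat \<Rightarrow> real \<Rightarrow> real \<Rightarrow> real \<Rightarrow> real \<Rightarrow> real" where
  "dbump sg i j a b u v = real (i + 2 * j) * bump i j a b u v + u ^ i * v ^ j *
     (if 0 < (b - (u + v)) * (u + v - a) then hderiv a b u v
      else if (b - (u + v)) * (u + v - a) = 0 then sg * max (sg * hderiv a b u v) 0 else 0)"

text \<open>A discrete product rule: the monomial contributes the factor
  \<open>t ^ (i + 2 * j)\<close>, and its increment is separated from that of the positive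
  part.\<close>

lemma bump_scale_diff:
  fixes t u v a b :: real
  defines "H \<equiv> \<lambda>t. (b - (t * u + t\<^sup>2 * v)) * (t * u + t\<^sup>2 * v - a)"
  shows "bump i j a b (t * u) (t\<^sup>2 * v) - bump i j a b u v =
    u ^ i * v ^ j * t ^ (i + 2 * j) * (max (H t) 0 - max (H 1) 0) +
    u ^ i * v ^ j * max (H 1) 0 * (t ^ (i + 2 * j) - 1)"
proof -
  have "(t * u) ^ i * (t\<^sup>2 * v) ^ j = t ^ (i + 2 * j) * (u ^ i * v ^ j)"
    by (simp add: power_mult_distrib power_add power_mult)
  then have "bump i j a b (t * u) (t\<^sup>2 * v) = t ^ (i + 2 * j) * (u ^ i * v ^ j) * max (H t) 0"
    by (simp only: bump_def H_def)
  moreover have "bump i j a b u v = u ^ i * v ^ j * max (H 1) 0"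
    by (simp add: bump_def H_def)
  ultimately show ?thesis
    by (simp only: ring_distribs mult_ac)
qed

lemma tendsto_bump_quotient:
  assumes t: "t \<longlonglongrightarrow> 1" and sg: "\<And>k. 0 < sg * (t k - 1)" "\<bar>sg\<bar> = 1"
  shows "(\<lambda>k. (bump i j a b (t k * u) ((t k)\<^sup>2 * v) - bump i j a b u v) / (t k - 1))
           \<longlonglongrightarrow> dbump sg i j a b u v"
proof -
  define H where "H = (\<lambda>t. (b - (t * u + t\<^sup>2 * v)) * (t * u + t\<^sup>2 * v - a))"
  define N where "N = i + 2 * j"
  have "(H has_field_derivative hderiv a b u v) (at 1)"
    unfolding H_def hderiv_def by (rule derivative_eq_intros refl | simp)+ (simp add: algebra_simps)
  note M = one_sided_derivative_max_0[OF this t sg]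
  have ne: "t k \<noteq> 1" for k
    using sg(1)[of k] by auto
  have "((\<lambda>t. t ^ N) has_field_derivative real N) (at (1::real))"
    by (rule derivative_eq_intros refl | simp)+
  then have "((\<lambda>y. (y ^ N - 1) / (y - 1)) \<longlongrightarrow> real N) (at (1::real))"
    by (simp add: has_field_derivative_iff)
  moreover have "filterlim t (at 1) sequentially"
    using t ne by (simp add: filterlim_at)
  ultimately have P: "(\<lambda>k. (t k ^ N - 1) / (t k - 1)) \<longlonglongrightarrow> real N"
    by (rule filterlim_compose)
  have "(bump i j a b (t k * u) ((t k)\<^sup>2 * v) - bump i j a b u v) / (t k - 1) =
    u ^ i * v ^ j * t k ^ N * ((max (H (t k)) 0 - max (H 1) 0) / (t k - 1)) +
    u ^ i * v ^ j * max (H 1) 0 * ((t k ^ N - 1) / (t k - 1))" for k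
    unfolding bump_scale_diff H_def N_def by (simp add: add_divide_distrib)
  moreover have "(\<lambda>k. u ^ i * v ^ j * t k ^ N * ((max (H (t k)) 0 - max (H 1) 0) / (t k - 1)) +
    u ^ i * v ^ j * max (H 1) 0 * ((t k ^ N - 1) / (t k - 1))) \<longlonglongrightarrow>
    u ^ i * v ^ j * 1 ^ N * (if 0 < H 1 then hderiv a b u v
      else if H 1 = 0 then sg * max (sg * hderiv a b u v) 0 else 0) +
    u ^ i * v ^ j * max (H 1) 0 * real N" (is "_ \<longlonglongrightarrow> ?L")
    by (intro tendsto_intros t M P)
  moreover have "?L = dbump sg i j a b u v"
    unfolding dbump_def bump_def H_def N_def by (simp del: mult_eq_0_iff)
  ultimately show ?thesis
    by simp
qed

lemma abs_power_minus_one_le: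
  fixes t :: real
  assumes "\<bar>t\<bar> \<le> 2"
  shows "\<bar>t ^ N - 1\<bar> \<le> \<bar>t - 1\<bar> * (real N * 2 ^ N)"
proof -
  have "\<bar>\<Sum>l<N. t ^ l\<bar> \<le> (\<Sum>l<N. \<bar>t ^ l\<bar>)"
    by (rule sum_abs)
  also have "\<dots> \<le> (\<Sum>l<N. 2 ^ N)"
  proof (rule sum_mono)
    fix l assume "l \<in> {..<N}"
    have "\<bar>t\<bar> ^ l \<le> 2 ^ l"
      using assms by (intro power_mono) auto
    also have "\<dots> \<le> (2::real) ^ N"
      using \<open>l \<in> {..<N}\<close> by (intro power_increasing) auto
    finally show "\<bar>t ^ l\<bar> \<le> 2 ^ N"
      by (simp add: power_abs)
  qed
  finally show ?thesis
    by (simp add: power_diff_1_eq abs_mult mult_left_mono)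
qed

text \<open>Gives the dominating constant for the difference quotients, uniformly over a ball on
  which \<open>u\<close> and \<open>v\<close> are bounded by \<open>R\<close>.\<close>

lemma bump_lipschitz:
  assumes "0 \<le> R"
  shows "\<exists>C\<ge>0. \<forall>t u v. 1 / 2 \<le> t \<longrightarrow> t \<le> 3 / 2 \<longrightarrow> \<bar>u\<bar> \<le> R \<longrightarrow> \<bar>v\<bar> \<le> R \<longrightarrow>
     \<bar>bump i j a b (t * u) (t\<^sup>2 * v) - bump i j a b u v\<bar> \<le> C * \<bar>t - 1\<bar>"
proof -
  define N where "N = i + 2 * j"
  \<comment> \<open>\<open>H t - H 1\<close> has the factor \<open>t - 1\<close>, and for
    \<open>t \<le> 3 / 2\<close> the two cofactors are at most \<open>4 * R\<close> and
    \<open>\<bar>a\<bar> + \<bar>b\<bar> + 6 * R\<close>. \<open>C2\<close> below bounds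
    \<open>H 1\<close>.\<close>
  define C1 where "C1 = 4 * R * (\<bar>a\<bar> + \<bar>b\<bar> + 6 * R)"
  define C2 where "C2 = (\<bar>b\<bar> + 2 * R) * (\<bar>a\<bar> + 2 * R)"
  define C where "C = R ^ i * R ^ j * 2 ^ N * C1 + R ^ i * R ^ j * C2 * (real N * 2 ^ N)"
  have nonneg: "0 \<le> C1" "0 \<le> C2"
    using assms by (auto simp: C1_def C2_def)
  have "\<bar>bump i j a b (t * u) (t\<^sup>2 * v) - bump i j a b u v\<bar> \<le> C * \<bar>t - 1\<bar>"
    if t: "1 / 2 \<le> t" "t \<le> 3 / 2" and u: "\<bar>u\<bar> \<le> R" and v: "\<bar>v\<bar> \<le> R" for t u v
  proof -
    define H where "H = (\<lambda>t. (b - (t * u + t\<^sup>2 * v)) * (t * u + t\<^sup>2 * v - a))"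
    have m: "\<bar>u ^ i * v ^ j\<bar> \<le> R ^ i * R ^ j"
      unfolding abs_mult power_abs using u v by (intro mult_mono power_mono) auto
    have tN: "\<bar>t ^ N\<bar> \<le> 2 ^ N"
      unfolding power_abs using t by (intro power_mono) auto
    have tu: "\<bar>t * u\<bar> \<le> 3 / 2 * R" and tv: "\<bar>t * v\<bar> \<le> 3 / 2 * R"
      unfolding abs_mult using t u v by (intro mult_mono; simp)+
    have ttv: "\<bar>t * (t * v)\<bar> \<le> 3 / 2 * (3 / 2 * R)"
      unfolding abs_mult[of t "t * v"] using t tv by (intro mult_mono) auto
    have "H t - H 1 = (t - 1) * (u + v + t * v) * (a + b - t * u - t * (t * v) - u - v)"
      unfolding H_def by (simp add: power2_eq_square) algebra
    then have "\<bar>H t - H 1\<bar> =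
        \<bar>t - 1\<bar> * \<bar>u + v + t * v\<bar> * \<bar>a + b - t * u - t * (t * v) - u - v\<bar>"
      by (simp add: abs_mult)
    also have "\<dots> \<le> \<bar>t - 1\<bar> * (4 * R) * (\<bar>a\<bar> + \<bar>b\<bar> + 6 * R)"
    proof (intro mult_mono)
      note bounds = u[unfolded abs_le_iff] v[unfolded abs_le_iff] tu[unfolded abs_le_iff]
        tv[unfolded abs_le_iff] ttv[unfolded abs_le_iff]
      show "\<bar>u + v + t * v\<bar> \<le> 4 * R"
        using bounds assms by (intro abs_leI; linarith)
      show "\<bar>a + b - t * u - t * (t * v) - u - v\<bar> \<le> \<bar>a\<bar> + \<bar>b\<bar> + 6 * R"
        using bounds assms abs_ge_self[of a] abs_ge_self[of b] abs_ge_minus_self[of a]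
          abs_ge_minus_self[of b] by (intro abs_leI; linarith)
    qed (use assms in auto)
    finally have "\<bar>H t - H 1\<bar> \<le> C1 * \<bar>t - 1\<bar>"
      by (simp add: C1_def mult_ac)
    then have 1: "\<bar>max (H t) 0 - max (H 1) 0\<bar> \<le> C1 * \<bar>t - 1\<bar>"
      by linarith
    have "\<bar>H 1\<bar> = \<bar>b - (u + v)\<bar> * \<bar>u + v - a\<bar>"
      by (simp add: H_def abs_mult)
    also have "\<dots> \<le> C2"
      unfolding C2_def using u v by (intro mult_mono) auto
    finally have 2: "\<bar>max (H 1) 0\<bar> \<le> C2"
      by linarith
    have 3: "\<bar>t ^ N - 1\<bar> \<le> \<bar>t - 1\<bar> * (real N * 2 ^ N)"
      using t by (intro abs_power_minus_one_le) auto
    have "\<bar>bump i j a b (t * u) (t\<^sup>2 * v) - bump i j a b u v\<bar> \<le>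
      \<bar>u ^ i * v ^ j\<bar> * \<bar>t ^ N\<bar> * \<bar>max (H t) 0 - max (H 1) 0\<bar> +
      \<bar>u ^ i * v ^ j\<bar> * \<bar>max (H 1) 0\<bar> * \<bar>t ^ N - 1\<bar>"
      unfolding bump_scale_diff H_def N_def abs_mult[symmetric] by (rule abs_triangle_ineq)
    also have "\<dots> \<le> R ^ i * R ^ j * 2 ^ N * (C1 * \<bar>t - 1\<bar>) +
      R ^ i * R ^ j * C2 * (\<bar>t - 1\<bar> * (real N * 2 ^ N))"
      using assms nonneg by (intro add_mono mult_mono m tN 1 2 3) auto
    also have "\<dots> = C * \<bar>t - 1\<bar>"
      by (simp add: C_def algebra_simps)
    finally show ?thesis .
  qed
  moreover have "0 \<le> C"
    unfolding C_def using assms nonneg by auto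
  ultimately show ?thesis
    by blast
qed

section \<open>Integrating radial derivatives over the whole space\<close>

lemma integrable_lborel_continuous_support:
  fixes f :: "'a::euclidean_space \<Rightarrow> real"
  assumes "continuous_on UNIV f" "\<And>x. x \<notin> cball 0 R \<Longrightarrow> f x = 0"
  shows "integrable lborel f"
proof -
  have "integrable lborel (\<lambda>x. indicator (cball 0 R) x *\<^sub>R f x)"
    using assms by (intro borel_integrable_compact) (auto intro: continuous_on_subset)
  also have "(\<lambda>x. indicator (cball 0 R) x *\<^sub>R f x) = f"
    using assms(2) by (intro ext) (simp split: split_indicator)
  finally show ?thesis .
qed

text \<open>In the integral identity the forms enter only through continuity, their scaling
  behaviour and boundedness of the set between the two levels.\<close>

locale homogeneous_pair =
  fixes u v :: "'a::euclidean_space \<Rightarrow> real" and a b :: real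
  assumes cont: "continuous_on UNIV u" "continuous_on UNIV v"
    and scale: "\<And>t x. u (t *\<^sub>R x) = t * u x" "\<And>t x. v (t *\<^sub>R x) = t\<^sup>2 * v x"
    and le: "a \<le> b"
    and bounded_sublevel: "bounded {x. a \<le> u x + v x \<and> u x + v x \<le> b}"
begin

abbreviation K where "K \<equiv> {x. a \<le> u x + v x \<and> u x + v x \<le> b}"

abbreviation h where "h x \<equiv> (b - (u x + v x)) * (u x + v x - a)"

lemma in_K_iff: "x \<in> K \<longleftrightarrow> 0 \<le> h x"
  using le by (auto simp: zero_le_mult_iff)

lemma measurable_uv [measurable]: "u \<in> borel_measurable borel" "v \<in> borel_measurable borel"
  using cont by (auto intro: borel_measurable_continuous_onI)

lemma bump_outside: "x \<notin> K \<Longrightarrow> bump i j a b (u x) (v x) = 0"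
  unfolding in_K_iff bump_def by simp

lemma continuous_on_bump: "continuous_on UNIV (\<lambda>x. bump i j a b (u x) (v x))"
  unfolding bump_def by (intro continuous_intros cont)

lemma measurable_bump [measurable]: "(\<lambda>x. bump i j a b (u x) (v x)) \<in> borel_measurable borel"
  unfolding bump_def by measurable

lemma measurable_dbump [measurable]: "(\<lambda>x. dbump sg i j a b (u x) (v x)) \<in> borel_measurable borel"
  unfolding dbump_def hderiv_def by measurable

text \<open>The integrals of the difference quotients have two limits. Dominated convergence gives
  the integral of \<open>dbump\<close>; the change of variables gives the derivative of the inverse
  of \<open>t ^ DIM('a)\<close> at 1 times the integral of \<open>bump\<close>.\<close>

lemma dbump_integral:
  assumes sg: "\<bar>sg\<bar> = 1"
  shows "integrable lborel (\<lambda>x. dbump sg i j a b (u x) (v x))"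
    and "(LINT x|lborel. dbump sg i j a b (u x) (v x)) =
      - real DIM('a) * (LINT x|lborel. bump i j a b (u x) (v x))"
proof -
  \<comment> \<open>The shift by 2 keeps \<open>t k\<close> within \<open>1 / 2\<close> of 1,
    strictly on the side given by \<open>sg\<close>.\<close>
  define t where "t k = 1 + sg / (real k + 2)" for k
  have sg2: "sg * sg = 1"
    using sg by (metis abs_mult_self_eq mult_1)
  have t1: "0 < sg * (t k - 1)" for k
    using sg2 by (simp add: t_def add_pos_nonneg)
  then have ne: "t k \<noteq> 1" for k
    by (metis diff_self less_irrefl mult_zero_right)
  have "(\<lambda>k. 1 + sg * (1 / (real k + 2))) \<longlonglongrightarrow> 1 + sg * 0"
    using LIMSEQ_ignore_initial_segment[OF lim_1_over_n, of 2]
    by (intro tendsto_intros) (simp add: add.commute)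
  then have t_lim: "t \<longlonglongrightarrow> 1"
    by (simp add: t_def[abs_def])
  have "\<bar>t k - 1\<bar> \<le> 1 / 2" for k
    using sg by (simp add: t_def abs_divide divide_simps)
  then have "t k - 1 \<le> 1 / 2" "- (t k - 1) \<le> 1 / 2" for k
    unfolding abs_le_iff by blast+
  then have t_bounds: "1 / 2 \<le> t k" "t k \<le> 3 / 2" for k
    by (simp_all add: field_simps)
  obtain r where r: "K \<subseteq> cball 0 r" "0 < r"
    using bounded_sublevel by (auto simp: bounded_pos subset_iff)
  \<comment> \<open>As \<open>t k\<close> is at least \<open>1 / 2\<close>, undoing the dilation at
    most doubles the radius; both functions in the quotient vanish outside the ball of radius
    \<open>2 * r\<close>.\<close>
  have K: "t k *\<^sub>R x \<in> K \<Longrightarrow> x \<in> cball 0 (2 * r)" "x \<in> K \<Longrightarrow> x \<in> cball 0 (2 * r)" for k x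
  proof -
    assume "t k *\<^sub>R x \<in> K"
    then have "t k * norm x \<le> r"
      using r t_bounds(1)[of k] by (auto simp: subset_iff)
    moreover have "1 / 2 * norm x \<le> t k * norm x"
      using t_bounds by (intro mult_right_mono) auto
    ultimately show "x \<in> cball 0 (2 * r)" by simp
  next
    assume "x \<in> K"
    then have "x \<in> cball 0 r"
      using r by blast
    then show "x \<in> cball 0 (2 * r)"
      using r(2) by simp
  qed
  define F where "F x = bump i j a b (u x) (v x)" for x
  have F_cont: "continuous_on UNIV F"
    unfolding F_def by (rule continuous_on_bump)
  have [measurable]: "F \<in> borel_measurable borel"
    using F_cont by (rule borel_measurable_continuous_onI)
  have F_scale: "F (t k *\<^sub>R x) = bump i j a b (t k * u x) ((t k)\<^sup>2 * v x)" for k x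
    by (simp add: F_def scale)
  have F0: "F x = 0" "F (t k *\<^sub>R x) = 0" if "x \<notin> cball 0 (2 * r)" for x k
    using K that bump_outside unfolding F_def by blast+
  have F_int: "integrable lborel F" "integrable lborel (\<lambda>x. F (t k *\<^sub>R x))" for k
    by (rule integrable_lborel_continuous_support[where R = "2 * r"];
        auto intro!: F_cont F0 continuous_intros continuous_on_compose2[OF F_cont])+
  have "bounded (u ` cball 0 (2 * r) \<union> v ` cball 0 (2 * r))"
    using cont by (auto intro!: compact_imp_bounded compact_continuous_image
        intro: continuous_on_subset)
  then obtain R where R: "0 < R" "\<forall>y\<in>u ` cball 0 (2 * r) \<union> v ` cball 0 (2 * r). norm y \<le> R"
    by (auto simp: bounded_pos)
  obtain C where C: "0 \<le> C" "\<And>t u v. 1 / 2 \<le> t \<Longrightarrow> t \<le> 3 / 2 \<Longrightarrow> \<bar>u\<bar> \<le> R \<Longrightarrow> \<bar>v\<bar> \<le> R \<Longrightarrow>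
     \<bar>bump i j a b (t * u) (t\<^sup>2 * v) - bump i j a b u v\<bar> \<le> C * \<bar>t - 1\<bar>"
    using bump_lipschitz[of R i j a b] R(1) by (metis less_imp_le)
  let ?s = "\<lambda>k x. (F (t k *\<^sub>R x) - F x) / (t k - 1)"
  let ?w = "\<lambda>x :: 'a. C * indicator (cball 0 (2 * r)) x :: real"
  have bound: "norm (?s k x) \<le> ?w x" for k x
  proof (cases "x \<in> cball 0 (2 * r)")
    case True
    then have "\<bar>F (t k *\<^sub>R x) - F x\<bar> \<le> C * \<bar>t k - 1\<bar>"
      using R(2) t_bounds unfolding F_scale F_def[of x] by (intro C(2)) auto
    then show ?thesis
      using True ne[of k] by (simp add: abs_divide pos_divide_le_eq)
  qed (simp add: F0)
  have lim: "(\<lambda>k. ?s k x) \<longlonglongrightarrow> dbump sg i j a b (u x) (v x)" for x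
    unfolding F_scale F_def[of x] using t_lim t1 sg by (rule tendsto_bump_quotient)
  have dmeas: "(\<lambda>x. dbump sg i j a b (u x) (v x)) \<in> borel_measurable lborel"
    by measurable
  have wint: "integrable lborel ?w"
    using emeasure_compact_finite[OF compact_cball, of "0 :: 'a" "2 * r"]
    by (intro integrable_mult_right integrable_real_indicator) auto
  have smeas: "?s k \<in> borel_measurable lborel" for k
    by measurable
  show "integrable lborel (\<lambda>x. dbump sg i j a b (u x) (v x))"
    by (rule integrable_dominated_convergence[where s = ?s and w = ?w])
       (intro dmeas smeas wint AE_I2 lim bound)+
  have "(\<lambda>k. LINT x|lborel. ?s k x) \<longlonglongrightarrow> (LINT x|lborel. dbump sg i j a b (u x) (v x))"
    by (rule integral_dominated_convergence[where s = ?s and w = ?w])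
       (intro dmeas smeas wint AE_I2 lim bound)+
  moreover have "(\<lambda>k. LINT x|lborel. ?s k x) \<longlonglongrightarrow> - real DIM('a) * (LINT x|lborel. F x)"
  proof -
    let ?p = "\<lambda>t :: real. inverse (t ^ DIM('a))"
    have int: "(LINT x|lborel. ?s k x) = (?p (t k) - ?p 1) / (t k - 1) * (LINT x|lborel. F x)" for k
    proof -
      have "0 < t k" using t_bounds(1)[of k] by linarith
      have "(LINT x|lborel. F (t k *\<^sub>R x)) = ?p (t k) * (LINT x|lborel. F x)"
        using integral_lborel_scaleR[of F "t k"] \<open>0 < t k\<close> by (simp add: field_simps)
      then show ?thesis
        using F_int by (simp add: left_diff_distrib)
    qed
    have "(?p has_field_derivative - real DIM('a)) (at 1)"
      by (rule derivative_eq_intros refl | simp)+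
    then have "((\<lambda>y. (?p y - ?p 1) / (y - 1)) \<longlongrightarrow> - real DIM('a)) (at 1)"
      by (simp only: has_field_derivative_iff)
    moreover have "filterlim t (at 1) sequentially"
      using t_lim ne by (simp add: filterlim_at)
    ultimately have "(\<lambda>k. (?p (t k) - ?p 1) / (t k - 1)) \<longlonglongrightarrow> - real DIM('a)"
      by (rule filterlim_compose)
    then show ?thesis
      unfolding int by (rule tendsto_mult_right)
  qed
  ultimately show "(LINT x|lborel. dbump sg i j a b (u x) (v x)) =
      - real DIM('a) * (LINT x|lborel. bump i j a b (u x) (v x))"
    unfolding F_def by (rule LIMSEQ_unique)
qed

text \<open>
  The left and right derivatives have the same integral. For \<open>i = j = 0\<close> their difference is
  \<open>\<bar>hderiv\<bar>\<close> on the zero set of \<open>h\<close> and \<open>0\<close> elsewhere.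
\<close>

lemma AE_hderiv_zero: "AE x in lborel. h x = 0 \<longrightarrow> hderiv a b (u x) (v x) = 0"
proof -
  let ?f = "\<lambda>x. dbump 1 0 0 a b (u x) (v x) - dbump (-1) 0 0 a b (u x) (v x)"
  have f: "?f x = (if h x = 0 then \<bar>hderiv a b (u x) (v x)\<bar> else 0)" for x
    unfolding dbump_def by (auto simp: bump_def abs_if simp del: mult_eq_0_iff)
  have "integrable lborel ?f" "(LINT x|lborel. ?f x) = 0"
    by (simp_all add: dbump_integral)
  then have "AE x in lborel. ?f x = 0"
    by (subst integral_nonneg_eq_0_iff_AE[symmetric]) (auto simp: f)
  then show ?thesis
    unfolding f by (auto elim!: eventually_mono simp del: mult_eq_0_iff)
qed

text \<open>By \<open>AE_hderiv_zero\<close> the integrand agrees almost everywhere with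
  \<open>dbump\<close> for \<open>sg = 1\<close> plus \<open>DIM('a)\<close> times
  \<open>bump\<close>, and \<open>dbump_integral\<close> makes the two integrals cancel.\<close>

lemma stokes:
  "(LINT x|lborel. indicator K x * (real (DIM('a) + i + 2 * j) * u x ^ i * v x ^ j * (b - u x - v x) *
      (u x + v x - a) + (u x + 2 * v x) * u x ^ i * v x ^ j * (a + b - 2 * u x - 2 * v x))) = 0"
  (is "(LINT x|lborel. ?q x) = 0")
proof -
  let ?f = "\<lambda>x. dbump 1 i j a b (u x) (v x) + real DIM('a) * bump i j a b (u x) (v x)"
  have qf: "?q x = ?f x" if "h x = 0 \<longrightarrow> hderiv a b (u x) (v x) = 0" for x
  proof -
    have q: "?q x = indicator K x * (real (DIM('a) + i + 2 * j) * (u x ^ i * v x ^ j * h x) +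
        u x ^ i * v x ^ j * hderiv a b (u x) (v x))"
      by (simp add: hderiv_def algebra_simps)
    consider "0 < h x" | "h x = 0" | "h x < 0" by linarith
    then show ?thesis
    proof cases
      case 1
      then have "x \<in> K" unfolding in_K_iff by simp
      with 1 show ?thesis unfolding q dbump_def bump_def by (simp add: algebra_simps)
    next
      case 2
      have "hderiv a b (u x) (v x) = 0" using that 2 by blast
      then show ?thesis unfolding q dbump_def bump_def 2 by simp
    next
      case 3
      then have "x \<notin> K" unfolding in_K_iff by simp
      have "\<not> 0 < h x" "h x \<noteq> 0" "max (h x) 0 = 0"
        using 3 less_imp_neq[OF 3] by (simp_all only: not_less less_imp_le max.absorb2 not_False_eq_True)
      with \<open>x \<notin> K\<close> show ?thesis
        unfolding q dbump_def bump_def by (simp only: if_False) simp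
    qed
  qed
  have "AE x in lborel. ?q x = ?f x"
    using AE_hderiv_zero by (rule eventually_mono) (rule qf)
  moreover have "K \<in> sets borel"
    by (intro borel_closed closed_Collect_conj closed_Collect_le continuous_intros cont)
  then have "?q \<in> borel_measurable lborel"
    by measurable
  moreover have "?f \<in> borel_measurable lborel"
    by measurable
  ultimately have "(LINT x|lborel. ?q x) = (LINT x|lborel. ?f x)"
    by (intro integral_cong_AE)
  also have "\<dots> = 0"
  proof -
    obtain r where "K \<subseteq> cball 0 r"
      using bounded_sublevel by (auto simp: bounded_pos subset_iff)
    then have "integrable lborel (\<lambda>x. bump i j a b (u x) (v x))"
      using bump_outside
      by (intro integrable_lborel_continuous_support[where R = r] continuous_on_bump) blast
    then show ?thesis
      by (simp add: dbump_integral)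
  qed
  finally show ?thesis .
qed

end

section \<open>The pushforward of the uniform measure\<close>

lemma measure_cube_pos: "0 < measure lborel (cbox (-1) (1 :: real ^ 'n))"
  by (subst measure_lborel_cbox_eq) (auto simp: Basis_vec_def inner_axis intro!: prod_pos)

lemma emeasure_cube:
  "emeasure lborel (cbox (-1) (1 :: real ^ 'n)) = ennreal (measure lborel (cbox (-1) (1 :: real ^ 'n)))"
  by (intro emeasure_eq_ennreal_measure) (simp add: emeasure_lborel_cbox_eq)

lemma integral_unif_cube:
  fixes f :: "real ^ 'n \<Rightarrow> real"
  assumes "f \<in> borel_measurable borel"
  shows "(LINT x|unif_cube. f x) =
    (LINT x|lborel. indicator (cbox (-1) 1) x * f x) / measure lborel (cbox (-1) (1 :: real ^ 'n))"
proof -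
  let ?c = "measure lborel (cbox (-1) (1 :: real ^ 'n))"
  have "unif_cube = density lborel (\<lambda>x :: real ^ 'n. ennreal (indicator (cbox (-1) 1) x / ?c))"
    unfolding unif_cube_def uniform_measure_def emeasure_cube using measure_cube_pos[where 'n = 'n]
    by (intro arg_cong2[where f = density] refl ext, subst divide_ennreal[symmetric])
       (auto simp: ennreal_indicator)
  then have "(LINT x|unif_cube. f x) =
      (LINT x|density lborel (\<lambda>x :: real ^ 'n. ennreal (indicator (cbox (-1) 1) x / ?c)). f x)"
    by (rule arg_cong)
  also have "\<dots> = (LINT x|lborel. indicator (cbox (-1) 1) x / ?c * f x)"
    using assms measure_cube_pos[where 'n = 'n] by (subst integral_density) auto
  finally show ?thesis
    by simp
qed

lemma compactly_supported_pushforward: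
  fixes g1 g2 :: "'n::finite rpoly"
  shows "compactly_supported (pushforward g1 g2) ((\<lambda>x. (peval g1 x, peval g2 x)) ` cbox (-1) 1)"
proof -
  let ?G = "\<lambda>x. (peval g1 x, peval g2 x)"
  let ?U = "unif_cube :: (real ^ 'n) measure"
  have G [measurable]: "?G \<in> borel_measurable borel"
    by (intro borel_measurable_continuous_onI continuous_intros)
  have sets_U [measurable_cong]: "sets ?U = sets borel" and space_U: "space ?U = UNIV"
    by (simp_all add: unif_cube_def)
  have cube: "emeasure lborel (cbox (-1) (1 :: real ^ 'n)) \<noteq> 0"
      "emeasure lborel (cbox (-1) (1 :: real ^ 'n)) \<noteq> \<infinity>"
    using measure_cube_pos[where 'n = 'n] by (simp_all only: emeasure_cube ennreal_eq_0_iff) auto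
  have "emeasure ?U UNIV = 1"
    using cube unfolding unif_cube_def by (simp add: ennreal_divide_self less_top)
  then have mass: "emeasure (pushforward g1 g2) UNIV = 1"
    unfolding pushforward_def by (subst emeasure_distr) (auto simp: space_U)
  have compact: "compact (?G ` cbox (-1) 1)"
    by (intro compact_continuous_image continuous_intros compact_cbox)
  have "AE x in ?U. ?G x \<in> ?G ` cbox (-1) 1"
    unfolding unif_cube_def by (rule AE_uniform_measureI) auto
  moreover have "{z \<in> space borel. z \<in> ?G ` cbox (-1) 1} \<in> sets borel"
    using compact by (simp add: borel_compact)
  ultimately have AE: "AE z in pushforward g1 g2. z \<in> ?G ` cbox (-1) 1"
    unfolding pushforward_def by (subst AE_distr_iff) auto
  show ?thesis
  proof (intro compactly_supported.intro compactly_supported_axioms.intro finite_measureI)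
    show "emeasure (pushforward g1 g2) (space (pushforward g1 g2)) \<noteq> \<infinity>"
      using mass by (simp add: pushforward_def)
    show "measure (pushforward g1 g2) UNIV = 1"
      using mass by (simp add: measure_def)
    show "sets (pushforward g1 g2) = sets borel"
      by (simp add: pushforward_def)
  qed (fact compact AE)+
qed

lemma pushforward_stokes:
  fixes g1 g2 :: "'n::finite rpoly"
  assumes hom: "homogeneous 1 g1" "homogeneous 2 g2" and "a \<le> b"
    and K: "{x. a \<le> peval (g1 + g2) x \<and> peval (g1 + g2) x \<le> b} \<subseteq> box (-1) 1"
  defines "S \<equiv> {z \<in> (\<lambda>x. (peval g1 x, peval g2 x)) ` cbox (-1) 1. a \<le> fst z + snd z \<and> fst z + snd z \<le> b}"
  assumes S: "S \<in> sets borel"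
  shows "(LINT z|pushforward g1 g2. indicator S z * beval (qpoly CARD('n) a b i j) z) = 0"
proof -
  let ?G = "\<lambda>x. (peval g1 x, peval g2 x)"
  let ?K = "{x. a \<le> peval g1 x + peval g2 x \<and> peval g1 x + peval g2 x \<le> b}"
  let ?q = "beval (qpoly CARD('n) a b i j)"
  have G [measurable]: "?G \<in> borel_measurable borel"
    by (intro borel_measurable_continuous_onI continuous_intros)
  have K_box: "?K \<subseteq> cbox (-1) 1"
    using K box_subset_cbox unfolding peval_add by blast
  interpret homogeneous_pair "peval g1" "peval g2" a b
  proof
    show "bounded ?K"
      using K_box bounded_cbox bounded_subset by blast
  qed (use hom peval_scaleR[of 1 g1] peval_scaleR[of 2 g2] \<open>a \<le> b\<close> in \<open>auto intro: continuous_on_peval\<close>)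
  note [measurable] = S
  have "(LINT z|pushforward g1 g2. indicator S z * ?q z) =
      (LINT x|unif_cube. indicator S (?G x) * ?q (?G x))"
    unfolding pushforward_def
    by (intro integral_distr) (simp_all add: unif_cube_def G del: beval_qpoly)
  also have "\<dots> = (LINT x|lborel. indicator (cbox (-1) 1) x * (indicator S (?G x) * ?q (?G x))) /
      measure lborel (cbox (-1) (1 :: real ^ 'n))"
    by (rule integral_unif_cube) measurable
  also have "(\<lambda>x. indicator (cbox (-1) 1) x * (indicator S (?G x) * ?q (?G x))) =
      (\<lambda>x. indicator ?K x * ?q (?G x))"
  proof
    fix x
    \<comment> \<open>The inclusion of \<open>?K\<close> in the cube absorbs the cube's indicator,
      so the integral becomes one over the whole space, as \<open>stokes\<close> requires.\<close>
    have "x \<in> cbox (-1) 1 \<and> ?G x \<in> S \<longleftrightarrow> x \<in> ?K"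
      using K_box by (auto simp: S_def)
    then show "indicator (cbox (-1) 1) x * (indicator S (?G x) * ?q (?G x)) = indicator ?K x * ?q (?G x)"
      by (auto simp: indicator_def simp del: beval_qpoly)
  qed
  also have "(LINT x|lborel. indicator ?K x * ?q (?G x)) = 0"
    using stokes[of i j] by simp
  finally show ?thesis by simp
qed

theorem proposition4p1:
  fixes g g1 g2 :: "'n::finite rpoly" and a b :: real
    and K :: "(real ^ 'n) set" and \<Theta> S :: "(real \<times> real) set"
    and \<Lambda> :: "(real \<times> real) measure"
  assumes "g = g1 + g2" and "homogeneous 1 g1" and "homogeneous 2 g2"
    and "a \<le> b"
  defines "K \<equiv> {x. a \<le> peval g x \<and> peval g x \<le> b}"
  assumes "K \<subseteq> box (-1) 1"
  defines "\<Lambda> \<equiv> pushforward g1 g2"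
    and "\<Theta> \<equiv> (\<lambda>x. (peval g1 x, peval g2 x)) ` cbox (-1) 1"
    and "S \<equiv> {z \<in> \<Theta>. a \<le> fst z + snd z \<and> fst z + snd z \<le> b}"
  shows "(\<forall>d\<ge>1.
            (\<exists>\<phi>. is_arg_max (\<lambda>\<phi>. \<phi> (0, 0)) (\<lambda>\<phi>. \<phi> \<in> rho_feasible a b \<Lambda> d) \<phi>) \<and>
            (\<exists>\<phi>. is_arg_max (\<lambda>\<phi>. \<phi> (0, 0)) (\<lambda>\<phi>. \<phi> \<in> tau_feasible CARD('n) a b \<Lambda> d) \<phi>)) \<and>
         (\<forall>d\<ge>1. measure \<Lambda> S \<le> tau CARD('n) a b \<Lambda> d \<and>
                tau CARD('n) a b \<Lambda> d \<le> rho a b \<Lambda> d) \<and>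
         antimono_on {1..} (tau CARD('n) a b \<Lambda>) \<and>
         tau CARD('n) a b \<Lambda> \<longlonglongrightarrow> measure \<Lambda> S"
proof -
  interpret compactly_supported \<Lambda> \<Theta>
    unfolding \<Lambda>_def \<Theta>_def by (rule compactly_supported_pushforward)
  define A where "A = {z :: real \<times> real. a \<le> fst z + snd z \<and> fst z + snd z \<le> b}"
  have A: "closed A"
    unfolding A_def by (intro closed_Collect_conj closed_Collect_le continuous_intros)
  have S_eq: "S = \<Theta> \<inter> A"
    by (auto simp: S_def A_def)
  have S: "S \<in> sets borel"
    unfolding S_eq using compact_T A by (intro sets.Int borel_compact borel_closed)
  \<comment> \<open>The upper bound concerns the strip \<open>A\<close>; since \<Lambda> is
    concentrated on \<Theta>, passing from \<open>S\<close> to \<open>A\<close> does not change the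
    measure.\<close>
  have measure_S: "measure \<Lambda> S = measure \<Lambda> A"
    using AE_T S A by (intro finite_measure_eq_AE) (auto simp: S_eq sets_M)
  have stokes: "(LINT z|\<Lambda>. indicator S z * beval (qpoly CARD('n) a b i j) z) = 0" for i j
    unfolding \<Lambda>_def S_def \<Theta>_def using assms S
    by (intro pushforward_stokes) (auto simp: K_def S_def \<Theta>_def)
  \<comment> \<open>These truncated moments make the feasible sets nonempty, and their entry at
    \<open>(0, 0)\<close> is \<open>measure \<Lambda> S\<close>, which gives the lower
    bound.\<close>
  let ?\<psi> = "\<lambda>d. restrict (moments_on S) (idx (2 * d))"
  have \<psi>: "?\<psi> d \<in> tau_feasible CARD('n) a b \<Lambda> d" if "1 \<le> d" for d
  proof -
    have "?\<psi> d \<in> rho_feasible a b \<Lambda> d"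
      using that S by (intro moments_on_feasible) (auto simp: S_def)
    moreover have "riesz (?\<psi> d) (qpoly CARD('n) a b i j) = 0"
      if "total_degree (qpoly CARD('n) a b i j) \<le> 2 * d" for i j
    proof -
      have "riesz (?\<psi> d) (qpoly CARD('n) a b i j) = riesz (moments_on S) (qpoly CARD('n) a b i j)"
        using keys_subset_idx_total_degree idx_mono[OF that] by (intro riesz_cong) auto
      then show ?thesis
        by (simp only: riesz_moments_on[OF S] stokes)
    qed
    ultimately show ?thesis
      by (simp add: tau_feasible_def)
  qed
  have rho_max: "\<exists>\<phi>. is_arg_max (\<lambda>\<phi>. \<phi> (0, 0)) (\<lambda>\<phi>. \<phi> \<in> rho_feasible a b \<Lambda> d) \<phi>" if "1 \<le> d" for d
    using \<psi>[OF that] tau_feasible_subset by (intro compact_is_arg_max_exists compact_rho_feasible) blast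
  have tau_max: "\<exists>\<phi>. is_arg_max (\<lambda>\<phi>. \<phi> (0, 0)) (\<lambda>\<phi>. \<phi> \<in> tau_feasible CARD('n) a b \<Lambda> d) \<phi>"
    if "1 \<le> d" for d
    using \<psi>[OF that] by (intro compact_is_arg_max_exists compact_tau_feasible) blast
  have tau_ge: "\<phi> (0, 0) \<le> tau CARD('n) a b \<Lambda> d"
    if "1 \<le> d" "\<phi> \<in> tau_feasible CARD('n) a b \<Lambda> d" for d \<phi>
  proof -
    obtain m where m: "is_arg_max (\<lambda>\<phi>. \<phi> (0, 0)) (\<lambda>\<phi>. \<phi> \<in> tau_feasible CARD('n) a b \<Lambda> d) m"
      using tau_max[OF \<open>1 \<le> d\<close>] by blast
    then show ?thesis
      unfolding tau_def Greatest_image_eq[OF m] using that(2) by (rule is_arg_max_ge)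
  qed
  have rho_ge: "\<phi> (0, 0) \<le> rho a b \<Lambda> d" if "1 \<le> d" "\<phi> \<in> rho_feasible a b \<Lambda> d" for d \<phi>
  proof -
    obtain m where m: "is_arg_max (\<lambda>\<phi>. \<phi> (0, 0)) (\<lambda>\<phi>. \<phi> \<in> rho_feasible a b \<Lambda> d) m"
      using rho_max[OF \<open>1 \<le> d\<close>] by blast
    then show ?thesis
      unfolding rho_def Greatest_image_eq[OF m] using that(2) by (rule is_arg_max_ge)
  qed
  have tau_attained: "\<exists>\<phi>\<in>tau_feasible CARD('n) a b \<Lambda> d. tau CARD('n) a b \<Lambda> d = \<phi> (0, 0)" if d: "1 \<le> d" for d
  proof -
    obtain m where m: "is_arg_max (\<lambda>\<phi>. \<phi> (0, 0)) (\<lambda>\<phi>. \<phi> \<in> tau_feasible CARD('n) a b \<Lambda> d) m"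
      using tau_max[OF d] by blast
    then show ?thesis
      unfolding tau_def Greatest_image_eq[OF m] by (auto simp: is_arg_max_def)
  qed
  have lower: "measure \<Lambda> S \<le> tau CARD('n) a b \<Lambda> d" if "1 \<le> d" for d
    using tau_ge[OF that \<psi>[OF that]] by (simp add: moments_on_0[OF S])
  have upper: "tau CARD('n) a b \<Lambda> d \<le> rho a b \<Lambda> d" if "1 \<le> d" for d
    using tau_attained[OF that] rho_ge[OF that] tau_feasible_subset by force
  \<comment> \<open>Truncating an optimal sequence of level \<open>e\<close> to level
    \<open>d\<close> keeps its entry at \<open>(0, 0)\<close>.\<close>
  have mono: "tau CARD('n) a b \<Lambda> e \<le> tau CARD('n) a b \<Lambda> d" if de: "1 \<le> d" "d \<le> e" for d e
  proof -
    obtain \<phi> where "\<phi> \<in> tau_feasible CARD('n) a b \<Lambda> e" "tau CARD('n) a b \<Lambda> e = \<phi> (0, 0)"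
      using tau_attained[of e] de by auto
    then show ?thesis
      using tau_ge[OF de(1) restrict_tau_feasible[OF _ de]] by simp
  qed
  have "tau CARD('n) a b \<Lambda> \<longlonglongrightarrow> measure \<Lambda> S"
  proof (rule LIMSEQ_I)
    fix \<epsilon> :: real assume "0 < \<epsilon>"
    \<comment> \<open>Optimal sequences for \<open>tau\<close> are feasible for \<open>rho\<close>,
      so \<open>rho_feasible_upper\<close> bounds \<open>tau\<close>; half of \<epsilon> leaves a
      strict inequality.\<close>
    then obtain D where D: "\<And>d \<phi>. D \<le> d \<Longrightarrow> \<phi> \<in> rho_feasible a b \<Lambda> d \<Longrightarrow>
        \<phi> (0, 0) \<le> measure \<Lambda> A + \<epsilon> / 2"
      using rho_feasible_upper[of a b "\<epsilon> / 2"] \<open>a \<le> b\<close> unfolding A_def by auto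
    have "norm (tau CARD('n) a b \<Lambda> d - measure \<Lambda> S) < \<epsilon>" if d: "max 1 D \<le> d" for d
    proof -
      obtain \<phi> where "\<phi> \<in> tau_feasible CARD('n) a b \<Lambda> d" "tau CARD('n) a b \<Lambda> d = \<phi> (0, 0)"
        using tau_attained[of d] d by auto
      then have "tau CARD('n) a b \<Lambda> d \<le> measure \<Lambda> S + \<epsilon> / 2"
        using D[of d \<phi>] tau_feasible_subset[of "CARD('n)" a b \<Lambda> d] d unfolding measure_S by auto
      then show ?thesis
        using lower[of d] d \<open>0 < \<epsilon>\<close> by simp
    qed
    then show "\<exists>N. \<forall>d\<ge>N. norm (tau CARD('n) a b \<Lambda> d - measure \<Lambda> S) < \<epsilon>"
      by blast
  qed
  then show ?thesis
    using rho_max tau_max lower upper mono by (auto simp: monotone_on_def)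
qed

end
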